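(* Let $f\in C^2(\mathbb{R})$ with $f''>0$ on $\mathbb{R}$, and let $\overline{u}_l=\overline{u}_r$ be a real constant. Let $w_{0l},w_{0r}\in L^\infty(\mathbb{R})$ be arbitrary periodic functions with periods $p_l>0$ and $p_r>0$ respectively, satisfying $$\frac{1}{p_l}\int_0^{p_l}w_{0l}(x)\,dx=\frac{1}{p_r}\int_0^{p_r}w_{0r}(x)\,dx=0.$$ Let $N>0$ and let $u_0\in L^\infty(\mathbb{R})$ satisfy $u_0(x)=\overline{u}_l+w_{0l}(x)$ for $x<-N$ and $u_0(x)=\overline{u}_r+w_{0r}(x)$ for $x>N$. Let $u$ be the entropy solution of $\partial_t u+\partial_x f(u)=0$ on $\mathbb{R}\times(0,\infty)$ with $u(\cdot,0)=u_0$. Then there exists a constant $C>0$, independent of $t$, such that $$\sup_{x\in\mathbb{R}}|u(x,t)-\overline{u}_l|\le\frac{C}{\sqrt{t}}\qquad\text{for all }t>0.$$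
   Context: For initial data $u_0\in L^\infty(\mathbb{R})$, the entropy solution of $\partial_t u+\partial_x f(u)=0$, $u(\cdot,0)=u_0$, is the unique bounded weak (distributional) solution satisfying, for some constant $E>0$ depending only on $f$ and $u_0$, $u(x+a,t)-u(x,t)\le \frac{Ea}{t}$ for a.e. $x\in\mathbb{R}$ and all $t>0$, $a>0$. For each $t>0$, $u(\cdot,t)$ has one-sided limits at every point; suprema in $x$ are understood as essential suprema (equivalently, for one-sided limits). *)

theory Defs
  imports "HOL-Probability.Essential_Supremum"
begin

definition Linf :: "'a measure \<Rightarrow> ('a \<Rightarrow> real) \<Rightarrow> bool" where
  "Linf M g \<longleftrightarrow> g \<in> borel_measurable M \<and> esssup M (\<lambda>x. ereal \<bar>g x\<bar>) < \<infinity>"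

text \<open>
  Elements of $L^\infty(R)$ are only determined almost everywhere, so the periodicity of such a
  function is an identity almost everywhere.
\<close>

definition periodic_ae :: "real \<Rightarrow> (real \<Rightarrow> real) \<Rightarrow> bool" where
  "periodic_ae p w \<longleftrightarrow> (AE x in lebesgue. w (x + p) = w x)"

text \<open>\<open>Ck k \<phi>\<close>: the function \<open>\<phi>\<close> of \<open>(x, t)\<close> is of class $C^k$ on the plane.\<close>

primrec Ck :: "nat \<Rightarrow> (real \<times> real \<Rightarrow> real) \<Rightarrow> bool" where
  "Ck 0 \<phi> \<longleftrightarrow> continuous_on UNIV \<phi>"
| "Ck (Suc k) \<phi> \<longleftrightarrow>
     (\<exists>\<phi>x \<phi>t. (\<forall>z. (\<phi> has_derivative (\<lambda>h. \<phi>x z * fst h + \<phi>t z * snd h)) (at z)) \<and>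
        Ck k \<phi>x \<and> Ck k \<phi>t)"

definition test_function :: "(real \<times> real \<Rightarrow> real) \<Rightarrow> bool" where
  "test_function \<phi> \<longleftrightarrow> (\<forall>k. Ck k \<phi>) \<and> (\<exists>K. compact K \<and> (\<forall>z. z \<notin> K \<longrightarrow> \<phi> z = 0))"

text \<open>
  The test functions need not vanish at \<open>t = 0\<close>: the boundary term there encodes the initial
  condition \<open>u(\<cdot>, 0) = u0\<close>.
\<close>

definition weak_solution ::
  "(real \<Rightarrow> real) \<Rightarrow> (real \<Rightarrow> real) \<Rightarrow> (real \<Rightarrow> real \<Rightarrow> real) \<Rightarrow> bool" where
  "weak_solution f u0 u \<longleftrightarrow>
     (\<forall>\<phi>. test_function \<phi> \<longrightarrow>
        (LINT z:UNIV \<times> {0<..}|lebesgue.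
           (case z of (x, t) \<Rightarrow>
              u x t * deriv (\<lambda>s. \<phi> (x, s)) t + f (u x t) * deriv (\<lambda>y. \<phi> (y, t)) x))
        + (LINT x|lebesgue. u0 x * \<phi> (x, 0)) = 0)"

definition oleinik_condition :: "(real \<Rightarrow> real \<Rightarrow> real) \<Rightarrow> bool" where
  "oleinik_condition u \<longleftrightarrow>
     (\<exists>E>0. \<forall>t>0. \<forall>a>0. AE x in lebesgue. u (x + a) t - u x t \<le> E * a / t)"

text \<open>
  The weak formulation does not see the values of \<open>u\<close> on a null set of times, whereas statements
  about \<open>u(\<cdot>, t)\<close> for every \<open>t > 0\<close> refer to the representative of \<open>u\<close> that is continuous in time
  with values in $L^1_{loc}(R)$.  The following condition selects this representative.
\<close>

definition time_continuous :: "(real \<Rightarrow> real \<Rightarrow> real) \<Rightarrow> bool" where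
  "time_continuous u \<longleftrightarrow>
     (\<forall>t>0. \<forall>R>0. ((\<lambda>s. LINT x:{-R..R}|lebesgue. \<bar>u x s - u x t\<bar>) \<longlongrightarrow> 0) (at t))"

text \<open>
  Only the values \<open>u x t\<close> with \<open>t > 0\<close> matter.
\<close>

definition entropy_solution ::
  "(real \<Rightarrow> real) \<Rightarrow> (real \<Rightarrow> real) \<Rightarrow> (real \<Rightarrow> real \<Rightarrow> real) \<Rightarrow> bool" where
  "entropy_solution f u0 u \<longleftrightarrow>
     Linf (lebesgue_on (UNIV \<times> {0<..})) (\<lambda>(x, t). u x t) \<and>
     (\<forall>t>0. Linf lebesgue (\<lambda>x. u x t)) \<and>
     time_continuous u \<and>
     weak_solution f u0 u \<and>
     oleinik_condition u"

end

theory Submission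
  imports Defs "HOL-Computational_Algebra.Polynomial"
begin

text \<open>
  Put \<open>w = u - c\<close> with \<open>c = ul\<close>. If all integrals of \<open>w(\<cdot>, t)\<close> over intervals are bounded by one
  constant \<open>Q\<close>, then the Oleinik condition, integrated on an interval of length \<open>\<bar>w\<bar> t / (2 E)\<close> to
  one side of a point, gives \<open>w\<^sup>2 \<le> 4 E Q / t\<close>. Initially such a bound holds because the
  perturbations are periodic with mean zero. It persists because a primitive \<open>V\<close> of \<open>w\<close> solves
  \<open>V\<^sub>t + f(c + V\<^sub>x) = f(c)\<close> and so obeys the maximum principle: at a near-minimum semiconcavity
  (the Oleinik condition) makes \<open>V\<^sub>x\<close> small, and at a near-maximum convexity of \<open>f\<close> bounds the flux
  from below by its tangent. Both arguments are carried out for primitives mollified in \<open>x\<close> at a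
  scale \<open>\<delta>\<close> which may depend on \<open>t\<close>, since the errors only have to be bounded.
\<close>

section \<open>A smooth step function\<close>

text \<open>The constant \<open>E / t\<close> in the Oleinik condition blows up at time 0, so
  semiconcavity is uniform only on some \<open>[a0, T]\<close> with \<open>a0 > 0\<close>. On the
  initial layer the flux is bounded crudely, and \<open>a0\<close> is so small that this moves the
  primitive by at most 1. On \<open>[a0, T]\<close> the extrema may drift at rate
  \<open>1 / T\<close>, which costs another 1. Hence the final constant does not depend on
  \<open>T\<close>, although every auxiliary scale does.

  The conservation law controls increments of a primitive between two points, so a primitive is
  determined only up to a function of time; that function is fixed by prescribing its time
  derivative.

  The two extrema need different arguments because a shock, where \<open>w\<close> jumps down, is a
  kink of maximum type: there \<open>w\<close> is not small, only its mean is.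

  The solution is given up to null sets, while the argument needs every positive time. Each slice is
  therefore replaced by a bounded Borel function, and continuity in time carries identities from
  almost all times to all times. Test functions must be differentiable to every order, which is why
  the mollifier comes from an explicit smooth function.\<close>

definition smooth_seq :: "(nat \<Rightarrow> real \<Rightarrow> real) \<Rightarrow> bool" where
  "smooth_seq D \<longleftrightarrow> (\<forall>n x. (D n has_real_derivative D (Suc n) x) (at x))"

text \<open>Serves the points where \<open>bump\<close> is glued to zero.\<close>

lemma has_real_derivative_0_of_quadratic_bound:
  fixes g :: "real \<Rightarrow> real"
  assumes "\<And>y. \<bar>g y\<bar> \<le> K * (y - x)\<^sup>2"
  shows "(g has_real_derivative 0) (at x)"
proof -
  have "g x = 0" using assms[of x] by simp
  have "((\<lambda>y. (g y - g x) / (y - x)) \<longlongrightarrow> 0) (at x)"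
  proof (rule Lim_null_comparison)
    show "\<forall>\<^sub>F y in at x. norm ((g y - g x) / (y - x)) \<le> K * \<bar>y - x\<bar>"
    proof (rule eventually_at_filter[THEN iffD2], rule always_eventually, intro allI impI)
      fix y :: real assume "y \<noteq> x"
      then show "norm ((g y - g x) / (y - x)) \<le> K * \<bar>y - x\<bar>"
        using assms[of y] \<open>g x = 0\<close>
        by (simp add: divide_le_eq power2_eq_square abs_mult_self_eq mult.assoc)
    qed
    show "((\<lambda>y. K * \<bar>y - x\<bar>) \<longlongrightarrow> 0) (at x)"
      by (auto intro!: tendsto_eq_intros)
  qed
  then show ?thesis by (simp add: has_field_derivative_iff)
qed

text \<open>With \<open>q = 1 / (x (1 - x))\<close>, the products of a polynomial, a power of
  \<open>q\<close> and \<open>exp (- q)\<close> form a family closed under differentiation.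
  Smoothness of every order thus reduces to one derivative formula.\<close>

definition bump :: "real poly \<Rightarrow> nat \<Rightarrow> real \<Rightarrow> real" where
  "bump P k x = (if 0 < x \<and> x < 1
     then poly P x * inverse (x * (1 - x)) ^ k * exp (- inverse (x * (1 - x))) else 0)"

text \<open>One term of the exponential series gives \<open>exp q\<close> at least
  \<open>q ^ (k + 2) / fact (k + 2)\<close>, so \<open>q ^ k * exp (- q)\<close> is at most a
  constant times the inverse square of \<open>q\<close>. The square is what makes the derivative
  vanish at the gluing points.\<close>

lemma bump_bound: "\<exists>K. \<forall>y. \<bar>bump P k y\<bar> \<le> K * (y * (1 - y))\<^sup>2 \<and> K \<ge> 0"
proof -
  have "bounded (poly P ` {0..1})"
    by (intro compact_imp_bounded compact_continuous_image continuous_intros) auto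
  then obtain B where "\<forall>y\<in>{0..1}. \<bar>poly P y\<bar> \<le> B"
    unfolding bounded_iff by auto
  then have B: "\<bar>poly P y\<bar> \<le> B" if "y \<in> {0..1}" for y using that by blast
  have B0: "B \<ge> 0" using B[of 0] by auto
  have "\<bar>bump P k y\<bar> \<le> B * fact (Suc (Suc k)) * (y * (1 - y))\<^sup>2" for y
  proof (cases "0 < y \<and> y < 1")
    case True
    define q where "q = inverse (y * (1 - y))"
    have q: "q > 0" using True by (simp add: q_def)
    have "q ^ Suc (Suc k) / fact (Suc (Suc k)) \<le> exp q"
    proof -
      have s: "(\<lambda>n. q ^ n /\<^sub>R fact n) sums exp q" by (rule exp_converges)
      have "(\<Sum>n\<in>{Suc (Suc k)}. q ^ n /\<^sub>R fact n) \<le> (\<Sum>n. q ^ n /\<^sub>R fact n)"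
        using q s by (intro sum_le_suminf) (auto simp: sums_iff)
      with s show ?thesis by (simp add: sums_iff divide_inverse mult.commute del: fact_Suc)
    qed
    then have "q ^ k * exp (- q) \<le> fact (Suc (Suc k)) * (inverse q)\<^sup>2"
      using q by (simp add: field_simps exp_minus power_add power2_eq_square del: fact_Suc)
    moreover have "\<bar>poly P y\<bar> \<le> B" using B True by auto
    ultimately have "\<bar>poly P y\<bar> * (q ^ k * exp (- q)) \<le> B * (fact (Suc (Suc k)) * (inverse q)\<^sup>2)"
      using q B0 by (auto intro!: mult_mono[of "\<bar>poly P y\<bar>" B] simp del: fact_Suc)
    then show ?thesis
      using True q by (simp add: bump_def q_def abs_mult mult.assoc)
  qed (use B0 in \<open>auto simp add: bump_def simp del: fact_Suc\<close>)
  with B0 show ?thesis by (intro exI[of _ "B * fact (Suc (Suc k))"]) auto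
qed

lemma bump_has_derivative:
  "(bump P k has_real_derivative
     bump (pderiv P * [:0, 1, -1:]\<^sup>2 - smult (real k) (P * [:1, -2:] * [:0, 1, -1:]) + P * [:1, -2:])
       (k + 2) x) (at x)"
proof (cases "0 < x \<and> x < 1")
  case True
  define r s q where "r = x * (1 - x)" and "s = 1 - 2 * x" and "q = inverse r"
  have r: "r > 0" using True by (auto simp: r_def)
  let ?Q = "pderiv P * [:0, 1, -1:]\<^sup>2 - smult (real k) (P * [:1, -2:] * [:0, 1, -1:]) + P * [:1, -2:]"
  have "((\<lambda>x. x * (1 - x)) has_real_derivative s) (at x)"
    by (auto intro!: derivative_eq_intros simp: s_def)
  then have q: "((\<lambda>x. inverse (x * (1 - x))) has_real_derivative - (s * q\<^sup>2)) (at x)"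
    unfolding q_def r_def
    by (rule DERIV_cong[OF DERIV_inverse_fun])
      (use r True in \<open>simp_all add: r_def power2_eq_square ac_simps\<close>)
  have d: "((\<lambda>x. poly P x * inverse (x * (1 - x)) ^ k * exp (- inverse (x * (1 - x)))) has_real_derivative
      poly (pderiv P) x * q ^ k * exp (- q) - poly P x * (real k * q ^ (k - 1) * (s * q\<^sup>2)) * exp (- q)
        + poly P x * q ^ k * (exp (- q) * (s * q\<^sup>2))) (at x)"
    by (rule DERIV_cong[OF DERIV_mult[OF DERIV_mult[OF poly_DERIV DERIV_power[OF q]]
            DERIV_fun_exp[OF DERIV_minus[OF q]]]])
      (simp add: q_def r_def algebra_simps del: inverse_mult_distrib)
  \<comment> \<open>The factor \<open>real k\<close> makes this true for \<open>k = 0\<close> as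
    well, where \<open>k - 1\<close> is truncated.\<close>
  have e1: "real k * q ^ (k - 1) = real k * q ^ k * r"
    using r by (cases k) (auto simp: q_def)
  have e2: "q ^ (k + 2) * r\<^sup>2 = q ^ k"
    using r by (simp add: q_def power_add field_simps power2_eq_square)
  have e3: "poly ?Q x = poly (pderiv P) x * r\<^sup>2 - real k * (poly P x * s * r) + poly P x * s"
    by (simp add: r_def s_def algebra_simps)
  have e4: "(A' * r\<^sup>2 - K * (A * s * r) + A * s) * q ^ (k + 2) * e
      = A' * (q ^ (k + 2) * r\<^sup>2) * e - A * (K * q ^ k * r * (s * q\<^sup>2)) * e + A * q ^ k * (e * (s * q\<^sup>2))"
    for A A' K e :: real
    by (simp add: power_add power2_eq_square algebra_simps)
  have "poly ?Q x * q ^ (k + 2) * exp (- q) =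
     poly (pderiv P) x * q ^ k * exp (- q) - poly P x * (real k * q ^ (k - 1) * (s * q\<^sup>2)) * exp (- q)
        + poly P x * q ^ k * (exp (- q) * (s * q\<^sup>2))"
    by (simp only: e1 e2 e3 e4)
  moreover have "bump ?Q (k + 2) x = poly ?Q x * q ^ (k + 2) * exp (- q)"
    using True by (simp only: bump_def q_def r_def if_True simp_thms)
  ultimately have "((\<lambda>x. poly P x * inverse (x * (1 - x)) ^ k * exp (- inverse (x * (1 - x)))) has_real_derivative
      bump ?Q (k + 2) x) (at x)"
    using d by (simp only:)
  then show ?thesis
    by (rule has_field_derivative_transform_within_open[where S = "{0<..<1}"])
      (use True in \<open>auto simp: bump_def\<close>)
next
  case False
  obtain K where K: "\<And>y. \<bar>bump P k y\<bar> \<le> K * (y * (1 - y))\<^sup>2" "K \<ge> 0"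
    using bump_bound by blast
  have "\<bar>bump P k y\<bar> \<le> K * (y - x)\<^sup>2" for y
  proof (cases "0 < y \<and> y < 1")
    case True
    have "y * (1 - y) \<le> y" "y * (1 - y) \<le> 1 - y" "0 \<le> y * (1 - y)"
      using True by (auto simp: mult_left_le mult_left_le_one_le)
    \<comment> \<open>Since \<open>x\<close> lies outside the open unit interval, its distance from
      \<open>y\<close> is at least the smaller of \<open>y\<close> and \<open>1 - y\<close>.\<close>
    then have "y * (1 - y) \<le> \<bar>y - x\<bar>" using False True by linarith
    then have "(y * (1 - y))\<^sup>2 \<le> (y - x)\<^sup>2"
      using \<open>0 \<le> y * (1 - y)\<close> by (metis power2_abs power_mono)
    then show ?thesis using K by (meson mult_left_mono order_trans)
  qed (use K in \<open>auto simp: bump_def\<close>)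
  then have d: "(bump P k has_real_derivative 0) (at x)"
    by (rule has_real_derivative_0_of_quadratic_bound)
  have "bump Q (k + 2) x = 0" for Q using False by (auto simp: bump_def)
  with d show ?thesis by (simp only:)
qed

text \<open>The recursion is the one in \<open>bump_has_derivative\<close>: since \<open>q = 1 / (x (1 - x))\<close> satisfies
  \<open>q' = (2 x - 1) q\<^sup>2\<close>, each derivative of \<open>exp (- q)\<close> costs two powers of \<open>q\<close>.\<close>

fun bump_poly :: "nat \<Rightarrow> real poly" where
  "bump_poly 0 = 1"
| "bump_poly (Suc n) = pderiv (bump_poly n) * [:0, 1, -1:]\<^sup>2
     - smult (real (2 * n)) (bump_poly n * [:1, -2:] * [:0, 1, -1:]) + bump_poly n * [:1, -2:]"

lemma smooth_seq_bump: "smooth_seq (\<lambda>n. bump (bump_poly n) (2 * n))"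
  using bump_has_derivative[of "bump_poly n" "2 * n" for n] by (simp add: smooth_seq_def)

text \<open>\<open>D n\<close> is the derivative of order \<open>n\<close> of a step that descends
  on \<open>[0, 1]\<close>. Descent makes \<open>- D 1\<close> a nonnegative kernel of mass one,
  later the mollifier.\<close>

definition smooth_step :: "(nat \<Rightarrow> real \<Rightarrow> real) \<Rightarrow> bool" where
  "smooth_step D \<longleftrightarrow> smooth_seq D \<and> (\<forall>x\<le>0. D 0 x = 1) \<and> (\<forall>x\<ge>1. D 0 x = 0) \<and>
     (\<forall>n x. x \<le> 0 \<or> x \<ge> 1 \<longrightarrow> D (Suc n) x = 0) \<and> (\<forall>x. D 1 x \<le> 0)"

text \<open>A primitive \<open>F\<close> of the bump is constant on either side of
  \<open>[0, 1]\<close> and strictly larger on the right; \<open>Z\<close> normalises the height of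
  the step to one.\<close>

lemma smooth_step_exists: "\<exists>D. smooth_step D"
proof -
  define b where "b n = bump (bump_poly n) (2 * n)" for n
  have b: "(b n has_real_derivative b (Suc n) x) (at x)" for n x
    using smooth_seq_bump by (simp add: smooth_seq_def b_def)
  have b_out: "b n x = 0" if "x \<le> 0 \<or> x \<ge> 1" for n x
    using that by (auto simp: b_def bump_def)
  have b_nonneg: "b 0 x \<ge> 0" for x by (auto simp: b_def bump_def)
  have b_pos: "b 0 x > 0" if "0 < x" "x < 1" for x using that by (auto simp: b_def bump_def)
  have "\<exists>F. \<forall>x. -\<infinity> < ereal x \<longrightarrow> ereal x < \<infinity> \<longrightarrow> (F has_vector_derivative b 0 x) (at x)"
    by (rule einterval_antiderivative) (use DERIV_isCont[OF b] in auto)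
  then obtain F where F: "\<And>x. (F has_real_derivative b 0 x) (at x)"
    by (auto simp: has_real_derivative_iff_has_vector_derivative)
  have F_cont: "continuous_on X F" for X
    using F by (meson DERIV_isCont continuous_at_imp_continuous_on)
  have F_pos: "F 0 < F 1"
    by (rule DERIV_pos_imp_increasing_open[of 0 1]) (use F b_pos F_cont in auto)
  have F_l: "F x = F 0" if "x \<le> 0" for x
  proof (cases "x = 0")
    case False
    have "DERIV F y :> 0" if "y < 0" for y using F[of y] b_out[of y] that by simp
    then show ?thesis
      using DERIV_isconst2[of x 0 F x] that False F_cont DERIV_isconst2[of x 0 F 0] by simp
  qed simp
  have F_r: "F x = F 1" if "x \<ge> 1" for x
  proof (cases "x = 1")
    case False
    have "DERIV F y :> 0" if "y > 1" for y using F[of y] b_out[of y] that by simp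
    then show ?thesis
      using DERIV_isconst2[of 1 x F x] that False F_cont by simp
  qed simp
  define Z where "Z = F 1 - F 0"
  define D where "D n = (case n of 0 \<Rightarrow> (\<lambda>x. (F 1 - F x) / Z) | Suc m \<Rightarrow> (\<lambda>x. - b m x / Z))" for n
  have "smooth_seq D"
    unfolding smooth_seq_def
  proof (intro allI)
    fix n x
    show "(D n has_real_derivative D (Suc n) x) (at x)"
    proof (cases n)
      case 0
      show ?thesis
        unfolding D_def 0 nat.case
        by (rule DERIV_cong[OF DERIV_cdivide[OF DERIV_diff[OF DERIV_const F]]]) simp
    next
      case (Suc m)
      show ?thesis
        unfolding D_def Suc nat.case by (rule DERIV_cdivide[OF DERIV_minus[OF b]])
    qed
  qed
  moreover have "D 0 x = 1" if "x \<le> 0" for x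
    using F_l[OF that] F_pos by (simp add: D_def Z_def)
  moreover have "D 0 x = 0" if "x \<ge> 1" for x
    using F_r[OF that] by (simp add: D_def)
  moreover have "D (Suc n) x = 0" if "x \<le> 0 \<or> x \<ge> 1" for n x
    using b_out[OF that, of n] by (simp add: D_def)
  moreover have "D 1 x \<le> 0" for x
    using b_nonneg[of x] F_pos by (simp add: D_def Z_def divide_nonneg_pos)
  ultimately have "smooth_step D" unfolding smooth_step_def by blast
  then show ?thesis by blast
qed

text \<open>Partial derivatives of the product have the same form with one index raised, so the
  induction must leave \<open>i\<close> and \<open>j\<close> arbitrary.\<close>

lemma Ck_product:
  assumes "smooth_seq A" "smooth_seq B"
  shows "Ck k (\<lambda>z. A i (fst z) * B j (snd z))"
proof (induction k arbitrary: i j)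
  case 0
  have "continuous_on UNIV (A i)" "continuous_on UNIV (B j)"
    using assms DERIV_isCont unfolding smooth_seq_def by (blast intro!: continuous_at_imp_continuous_on)+
  then show ?case
    by (auto intro!: continuous_intros elim: continuous_on_compose2)
next
  case (Suc k)
  show ?case unfolding Ck.simps
  proof (intro exI conjI allI)
    fix z :: "real \<times> real"
    have A: "(A i has_derivative (\<lambda>h. A (Suc i) (fst z) * h)) (at (fst z))"
      and B: "(B j has_derivative (\<lambda>h. B (Suc j) (snd z) * h)) (at (snd z))"
      using assms by (auto simp: smooth_seq_def has_field_derivative_def)
    have "((\<lambda>z. A i (fst z)) has_derivative (\<lambda>h. A (Suc i) (fst z) * fst h)) (at z)"
      using has_derivative_compose[OF has_derivative_fst[OF has_derivative_ident] A] by simp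
    moreover have "((\<lambda>z. B j (snd z)) has_derivative (\<lambda>h. B (Suc j) (snd z) * snd h)) (at z)"
      using has_derivative_compose[OF has_derivative_snd[OF has_derivative_ident] B] by simp
    ultimately show "((\<lambda>z. A i (fst z) * B j (snd z)) has_derivative
        (\<lambda>h. A (Suc i) (fst z) * B j (snd z) * fst h + A i (fst z) * B (Suc j) (snd z) * snd h)) (at z)"
      by (auto intro!: derivative_eq_intros simp: algebra_simps)
  qed (use Suc in auto)
qed

section \<open>Slices of functions on the half-plane\<close>

lemma Linf_bound:
  assumes "Linf M g"
  obtains B where "B \<ge> 0" "AE x in M. \<bar>g x\<bar> \<le> B"
proof -
  let ?e = "esssup M (\<lambda>x. ereal \<bar>g x\<bar>)"
  have "?e < \<infinity>" using assms by (simp add: Linf_def)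
  then obtain B where "?e \<le> ereal B" by (cases ?e) auto
  then have "AE x in M. \<bar>g x\<bar> \<le> max 0 B"
    using esssup_AE[where M = M and f = "\<lambda>x. ereal \<bar>g x\<bar>"]
    by (auto elim!: eventually_mono) (metis ereal_less_eq(3) order_trans max.coboundedI2)
  then show ?thesis using that[of "max 0 B"] by auto
qed

text \<open>Truncation at \<plusminus>\<open>B\<close> turns the almost everywhere bound into one
  valid at every point.\<close>

lemma bounded_borel_representative:
  fixes g :: "real \<Rightarrow> real"
  assumes g: "g \<in> borel_measurable lebesgue" and bound: "AE x in lebesgue. \<bar>g x\<bar> \<le> B" and "B \<ge> 0"
  obtains h where "h \<in> borel_measurable borel" "\<And>x. \<bar>h x\<bar> \<le> B" "AE x in lebesgue. g x = h x"
proof -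
  obtain g' where g': "g' \<in> borel_measurable lborel" "AE x in lborel. g x = g' x"
    using completion_ex_borel_measurable_real[OF g] by auto
  show ?thesis
  proof (rule that)
    show "(\<lambda>x. max (- B) (min B (g' x))) \<in> borel_measurable borel" using g'(1) by simp
    show "\<bar>max (- B) (min B (g' x))\<bar> \<le> B" for x using \<open>B \<ge> 0\<close> by auto
    show "AE x in lebesgue. g x = max (- B) (min B (g' x))"
      using bound AE_completion[OF g'(2)] by eventually_elim auto
  qed
qed

text \<open>The exceptional set is first enclosed in a measurable null set, since exchanging the two
  quantifiers requires a measurable set.\<close>

lemma AE_lborel_prod_snd:
  fixes Q :: "real \<times> real \<Rightarrow> bool"
  assumes "AE z in lborel. Q z"
  shows "AE t in lborel. AE x in lborel. Q (x, t)"
proof -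
  from AE_E[OF assms] obtain N :: "(real \<times> real) set"
    where N: "{z. \<not> Q z} \<subseteq> N" "emeasure lborel N = 0" "N \<in> sets lborel"
    by auto
  have "AE z in lborel \<Otimes>\<^sub>M lborel. z \<notin> N"
    unfolding lborel_prod using N by (intro AE_not_in) (auto simp: null_sets_def)
  then have "AE x in lborel. AE t in lborel. (x, t) \<notin> N"
    by (rule lborel_pair.AE_pair)
  moreover have "{z \<in> space (lborel \<Otimes>\<^sub>M lborel). (fst z, snd z) \<notin> N} \<in> sets (lborel \<Otimes>\<^sub>M lborel)"
  proof -
    have "{z \<in> space (lborel \<Otimes>\<^sub>M lborel). (fst z, snd z) \<notin> N} = UNIV - N"
      by (auto simp: space_pair_measure)
    then show ?thesis using N(3) unfolding lborel_prod by auto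
  qed
  ultimately have "AE t in lborel. AE x in lborel. (x, t) \<notin> N"
    using lborel_pair.AE_commute[of "\<lambda>x t. (x, t) \<notin> N"] by simp
  then show ?thesis by eventually_elim (use N(1) in \<open>auto elim!: eventually_mono\<close>)
qed

text \<open>Fubini is applied to a Borel function equal to \<open>\<Phi>\<close> almost everywhere.
  It carries over to the completed measure because almost every horizontal slice of the exceptional
  set is null.\<close>

lemma integral_lebesgue_prod:
  fixes \<Phi> :: "real \<times> real \<Rightarrow> real"
  assumes int: "integrable lebesgue \<Phi>"
    and slice: "\<And>t. (\<lambda>x. \<Phi> (x, t)) \<in> borel_measurable lebesgue"
    and meas: "(\<lambda>t. LINT x|lebesgue. \<Phi> (x, t)) \<in> borel_measurable lebesgue"
  shows "(LINT z|lebesgue. \<Phi> z) = (LINT t|lebesgue. LINT x|lebesgue. \<Phi> (x, t))"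
proof -
  obtain \<Psi> where \<Psi>[measurable]: "\<Psi> \<in> borel_measurable lborel" and eq: "AE z in lborel. \<Phi> z = \<Psi> z"
    using completion_ex_borel_measurable_real[OF borel_measurable_integrable[OF int]] by auto
  have eq': "AE z in lebesgue. \<Phi> z = \<Psi> z" using eq by (rule AE_completion)
  have "integrable lebesgue \<Psi>"
    by (rule integrable_cong_AE_imp[OF int])
      (use eq' in \<open>auto intro: measurable_completion elim: eventually_mono\<close>)
  then have int': "integrable lborel \<Psi>" by (simp add: integrable_completion)
  then have int'': "integrable (lborel \<Otimes>\<^sub>M lborel) (case_prod (\<lambda>x t. \<Psi> (x, t)))"
    by (simp add: lborel_prod)
  have "(LINT z|lebesgue. \<Phi> z) = (LINT z|lebesgue. \<Psi> z)"
    using int eq' by (intro integral_cong_AE)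
      (auto intro: borel_measurable_integrable measurable_completion)
  also have "\<dots> = (LINT z|lborel. \<Psi> z)" by (simp add: integral_completion)
  also have "\<dots> = (LINT t|lborel. LINT x|lborel. \<Psi> (x, t))"
    using lborel_pair.integral_snd[OF int''] by (simp add: lborel_prod)
  also have "\<dots> = (LINT t|lebesgue. LINT x|lborel. \<Psi> (x, t))"
    using borel_measurable_integrable[OF lborel_pair.integrable_snd[OF int'']]
    by (simp add: integral_completion)
  also have "\<dots> = (LINT t|lebesgue. LINT x|lebesgue. \<Phi> (x, t))"
  proof (rule integral_cong_AE)
    show "(\<lambda>t. LINT x|lborel. \<Psi> (x, t)) \<in> borel_measurable lebesgue"
      using borel_measurable_integrable[OF lborel_pair.integrable_snd[OF int'']]
      by (simp add: measurable_completion)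
    have "AE t in lborel. (LINT x|lborel. \<Psi> (x, t)) = (LINT x|lebesgue. \<Phi> (x, t))"
      using AE_lborel_prod_snd[OF eq]
    proof eventually_elim
      case (elim t)
      have m: "(\<lambda>x. \<Psi> (x, t)) \<in> borel_measurable lborel"
        using measurable_compose[OF _ \<Psi>, of "\<lambda>x. (x, t)" lborel] by simp
      have "(LINT x|lborel. \<Psi> (x, t)) = (LINT x|lebesgue. \<Psi> (x, t))"
        using m by (simp add: integral_completion)
      also have "\<dots> = (LINT x|lebesgue. \<Phi> (x, t))"
        using AE_completion[OF elim] m slice
        by (intro integral_cong_AE) (auto intro: measurable_completion elim: eventually_mono)
      finally show ?case .
    qed
    then show "AE t in lebesgue. (LINT x|lborel. \<Psi> (x, t)) = (LINT x|lebesgue. \<Phi> (x, t))"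
      by (rule AE_completion)
  qed (rule meas)
  finally show ?thesis .
qed

section \<open>The smooth step, fixed once, and its rescalings\<close>

definition sstep :: "nat \<Rightarrow> real \<Rightarrow> real" where
  "sstep = (SOME D. smooth_step D)"

lemma smooth_step_sstep: "smooth_step sstep"
  unfolding sstep_def using smooth_step_exists by (rule someI_ex)

lemma sstep_DERIV: "(sstep n has_real_derivative sstep (Suc n) x) (at x)"
  using smooth_step_sstep by (auto simp: smooth_step_def smooth_seq_def)

lemma sstep_cont [continuous_intros]: "continuous_on A g \<Longrightarrow> continuous_on A (\<lambda>x. sstep n (g x))"
  using continuous_on_compose2[of UNIV "sstep n" A g] DERIV_isCont[OF sstep_DERIV]
  by (auto intro: continuous_at_imp_continuous_on)

lemma sstep_left: "x \<le> 0 \<Longrightarrow> sstep 0 x = 1" and sstep_right: "x \<ge> 1 \<Longrightarrow> sstep 0 x = 0"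
  and sstep_out: "x \<le> 0 \<or> x \<ge> 1 \<Longrightarrow> sstep (Suc n) x = 0"
  and sstep_1_nonpos: "sstep (Suc 0) x \<le> 0"
  using smooth_step_sstep by (auto simp: smooth_step_def)

lemma sstep_antimono: "x \<le> y \<Longrightarrow> sstep 0 y \<le> sstep 0 x"
  by (rule DERIV_nonpos_imp_nonincreasing) (use sstep_DERIV[of 0] sstep_1_nonpos in blast)+

lemma sstep_range: "0 \<le> sstep 0 x" "sstep 0 x \<le> 1"
  using sstep_antimono[of x "max 1 x"] sstep_antimono[of "min 0 x" x] by (simp_all add: sstep_left sstep_right)

lemma sstep_bounded: "\<exists>B\<ge>0. \<forall>x. \<bar>sstep n x\<bar> \<le> B"
proof (cases n)
  case 0
  then show ?thesis using sstep_range by (intro exI[of _ 1]) (auto simp: abs_le_iff intro: order_trans)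
next
  case (Suc m)
  have "bounded (sstep n ` {0..1})"
    by (intro compact_imp_bounded compact_continuous_image continuous_intros) auto
  then obtain B where "\<forall>x\<in>{0..1}. \<bar>sstep n x\<bar> \<le> B" unfolding bounded_iff by auto
  then have "\<bar>sstep n x\<bar> \<le> max 0 B" for x
    using sstep_out[of x m] Suc by (cases "x \<in> {0..1}") (auto simp: max_def)
  then show ?thesis by (intro exI[of _ "max 0 B"]) auto
qed

lemma sstep_measurable [measurable]: "sstep n \<in> borel_measurable borel"
  by (intro borel_measurable_continuous_onI continuous_intros)

lemma smooth_seq_affine: "smooth_seq D \<Longrightarrow> smooth_seq (\<lambda>n x. (1 / d) ^ n * D n ((x - c) / d))"
  unfolding smooth_seq_def
proof (intro allI)
  fix n x assume D: "\<forall>n x. (D n has_real_derivative D (Suc n) x) (at x)"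
  have i: "((\<lambda>x. (x - c) / d) has_real_derivative 1 / d) (at x)"
    by (rule DERIV_cong[OF DERIV_cdivide[OF DERIV_diff[OF DERIV_ident DERIV_const]]]) simp
  show "((\<lambda>x. (1 / d) ^ n * D n ((x - c) / d)) has_real_derivative
        (1 / d) ^ Suc n * D (Suc n) ((x - c) / d)) (at x)"
    by (rule DERIV_cong[OF DERIV_cmult[OF DERIV_chain2[OF D[rule_format] i]]]) simp
qed

lemma smooth_seq_diff: "smooth_seq D \<Longrightarrow> smooth_seq D' \<Longrightarrow> smooth_seq (\<lambda>n x. D n x - D' n x)"
  unfolding smooth_seq_def by (intro allI DERIV_diff) auto

section \<open>Integrability, bounds and time continuity of slices\<close>

lemma integrable_bounded_support:
  fixes g :: "real \<Rightarrow> real"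
  assumes "g \<in> borel_measurable lborel" "\<And>x. \<bar>g x\<bar> \<le> K" "\<And>x. x \<notin> {a..b} \<Longrightarrow> g x = 0"
  shows "integrable lborel g"
  by (rule integrableI_bounded_set[where A = "{a..b}" and B = K])
    (use assms in \<open>auto simp: emeasure_lborel_Icc_eq\<close>)

lemma set_integrable_lebesgue_bounded:
  fixes g :: "real \<Rightarrow> real"
  assumes "g \<in> borel_measurable lebesgue" "AE x in lebesgue. \<bar>g x\<bar> \<le> K"
  shows "set_integrable lebesgue {a..b} g"
  unfolding set_integrable_def
proof (rule integrableI_bounded_set[where A = "{a..b}" and B = K])
  show "emeasure lebesgue {a..b} < \<infinity>" by (simp add: emeasure_lborel_Icc_eq)
  show "AE x\<in>{a..b} in lebesgue. norm (indicat_real {a..b} x *\<^sub>R g x) \<le> K"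
    using assms(2) by eventually_elim auto
  show "(\<lambda>x. indicat_real {a..b} x *\<^sub>R g x) \<in> borel_measurable lebesgue"
    using assms(1) by (intro borel_measurable_scaleR borel_measurable_indicator) auto
qed auto

lemma AE_lborel_ex_interval:
  fixes a b :: real
  assumes "AE s in lborel. P s" "a < b"
  obtains s where "a < s" "s < b" "P s"
proof -
  obtain N where N: "{s. \<not> P s} \<subseteq> N" "emeasure lborel N = 0" "N \<in> sets lborel"
    using AE_E[OF assms(1)] by auto
  have "\<not> {a<..<b} \<subseteq> N"
  proof
    assume "{a<..<b} \<subseteq> N"
    then have "emeasure lborel {a<..<b} \<le> emeasure lborel N" using N(3) by (rule emeasure_mono)
    then show False using N(2) assms(2) by simp
  qed
  then obtain s where "s \<in> {a<..<b}" "s \<notin> N" by blast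
  then show ?thesis using N(1) that[of s] by auto
qed

text \<open>Times with the bound exist in every interval. If \<open>s\<close> is such a time near
  \<open>t\<close>, the excess of \<open>\<bar>u x t\<bar>\<close> over \<open>M\<close> is at most
  \<open>\<bar>u x s - u x t\<bar>\<close>, whose local integral tends to 0.\<close>

lemma slice_bound:
  assumes meas: "\<And>t. t > 0 \<Longrightarrow> Linf lebesgue (\<lambda>x. u x t)"
    and cont: "time_continuous u"
    and bound: "AE t in lborel. t > 0 \<longrightarrow> (AE x in lebesgue. \<bar>u x t\<bar> \<le> M)"
    and "t > 0"
  shows "AE x in lebesgue. \<bar>u x t\<bar> \<le> M"
proof -
  have int: "set_integrable lebesgue {-R..R} (\<lambda>x. g (u x s) (u x t))"
    if "s > 0" and g: "g = (\<lambda>a b. \<bar>a - b\<bar>) \<or> g = (\<lambda>a b. max 0 (\<bar>b\<bar> - M))" for s R g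
  proof -
    have [measurable]: "(\<lambda>x. u x s) \<in> borel_measurable lebesgue" "(\<lambda>x. u x t) \<in> borel_measurable lebesgue"
      using meas[OF \<open>s > 0\<close>] meas[OF \<open>t > 0\<close>] by (auto simp: Linf_def)
    obtain B1 where B1: "B1 \<ge> 0" "AE x in lebesgue. \<bar>u x s\<bar> \<le> B1" using Linf_bound[OF meas[OF \<open>s > 0\<close>]] .
    obtain B2 where B2: "B2 \<ge> 0" "AE x in lebesgue. \<bar>u x t\<bar> \<le> B2" using Linf_bound[OF meas[OF \<open>t > 0\<close>]] .
    show ?thesis
    proof (rule set_integrable_lebesgue_bounded[where K = "B1 + B2 + \<bar>M\<bar>"])
      show "(\<lambda>x. g (u x s) (u x t)) \<in> borel_measurable lebesgue" using g by auto
      show "AE x in lebesgue. \<bar>g (u x s) (u x t)\<bar> \<le> B1 + B2 + \<bar>M\<bar>"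
        using B1(2) B2(2) by eventually_elim (use g B1(1) B2(1) in auto)
    qed
  qed
  have "AE x in lebesgue. x \<in> {-R..R} \<longrightarrow> \<bar>u x t\<bar> \<le> M" if "R > 0" for R :: real
  proof -
    define D where "D = (LINT x:{-R..R}|lebesgue. max 0 (\<bar>u x t\<bar> - M))"
    have int': "set_integrable lebesgue {-R..R} (\<lambda>x. max 0 (\<bar>u x t\<bar> - M))"
      using int[of t "\<lambda>a b. max 0 (\<bar>b\<bar> - M)" R] \<open>t > 0\<close> by simp
    have "D \<le> e" if "e > 0" for e
    proof -
      have "((\<lambda>s. LINT x:{-R..R}|lebesgue. \<bar>u x s - u x t\<bar>) \<longlongrightarrow> 0) (at t)"
        using cont \<open>t > 0\<close> \<open>R > 0\<close> by (simp add: time_continuous_def)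
      then have "\<forall>\<^sub>F s in at t. (LINT x:{-R..R}|lebesgue. \<bar>u x s - u x t\<bar>) < e"
        using \<open>e > 0\<close> by (rule order_tendstoD)
      then obtain d where d: "d > 0"
        "\<And>s. s \<noteq> t \<Longrightarrow> dist s t < d \<Longrightarrow> (LINT x:{-R..R}|lebesgue. \<bar>u x s - u x t\<bar>) < e"
        by (auto simp: eventually_at)
      \<comment> \<open>Looking to the right of \<open>t\<close> keeps \<open>s\<close>
        positive.\<close>
      obtain s where s: "t < s" "s < t + d" "s > 0 \<longrightarrow> (AE x in lebesgue. \<bar>u x s\<bar> \<le> M)"
        using AE_lborel_ex_interval[OF bound, of t "t + d"] d(1) by auto
      then have sb: "AE x in lebesgue. \<bar>u x s\<bar> \<le> M" using \<open>t > 0\<close> by auto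
      have "D \<le> (LINT x:{-R..R}|lebesgue. \<bar>u x s - u x t\<bar>)"
        unfolding D_def
      proof (rule set_integral_mono_AE[OF int'])
        show "set_integrable lebesgue {-R..R} (\<lambda>x. \<bar>u x s - u x t\<bar>)"
          using int[of s "\<lambda>a b. \<bar>a - b\<bar>" R] s \<open>t > 0\<close> by simp
        show "AE x\<in>{-R..R} in lebesgue. max 0 (\<bar>u x t\<bar> - M) \<le> \<bar>u x s - u x t\<bar>"
          using sb by eventually_elim auto
      qed
      also have "\<dots> < e" using d(2)[of s] s by (auto simp: dist_real_def)
      finally show ?thesis by simp
    qed
    then have "D \<le> 0" using field_le_epsilon[of D 0] by simp
    moreover have "D \<ge> 0" unfolding D_def set_lebesgue_integral_def by (intro integral_nonneg_AE) auto
    ultimately have "D = 0" by simp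
    then have "AE x in lebesgue. indicat_real {-R..R} x *\<^sub>R max 0 (\<bar>u x t\<bar> - M) = 0"
      using int' unfolding D_def set_lebesgue_integral_def set_integrable_def
      by (subst (asm) integral_nonneg_eq_0_iff_AE) auto
    then show ?thesis by eventually_elim (auto simp: max_def split: if_splits)
  qed
  then have "AE x in lebesgue. x \<in> {- real (Suc n)..real (Suc n)} \<longrightarrow> \<bar>u x t\<bar> \<le> M" for n
    using of_nat_0_less_iff zero_less_Suc by blast
  then have "AE x in lebesgue. \<forall>n. x \<in> {- real (Suc n)..real (Suc n)} \<longrightarrow> \<bar>u x t\<bar> \<le> M"
    unfolding AE_all_countable by (rule allI)
  then show ?thesis
  proof eventually_elim
    case (elim x)
    obtain n where "\<bar>x\<bar> \<le> real n" using real_arch_simple by blast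
    then have "x \<in> {- real (Suc n)..real (Suc n)}" by auto
    then show ?case using elim by blast
  qed
qed

text \<open>The values at \<open>s\<close> and \<open>t\<close> differ by at most
  \<open>L * B\<close> times the local integral of \<open>\<bar>v s x - v t x\<bar>\<close>.
  \<open>G\<close> will be the identity for the density, and \<open>f\<close> up to a constant for
  the flux.\<close>

lemma isCont_slice_integral:
  fixes v :: "real \<Rightarrow> real \<Rightarrow> real" and G A :: "real \<Rightarrow> real"
  assumes v[measurable]: "\<And>t. v t \<in> borel_measurable borel" and bound: "\<And>t x. \<bar>v t x\<bar> \<le> M"
    and cont: "\<And>R. R > 0 \<Longrightarrow> ((\<lambda>s. LINT x:{-R..R}|lborel. \<bar>v s x - v t x\<bar>) \<longlongrightarrow> 0) (at t)"
    and G[measurable]: "G \<in> borel_measurable borel"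
    and lip: "\<And>p q. \<bar>p\<bar> \<le> M \<Longrightarrow> \<bar>q\<bar> \<le> M \<Longrightarrow> \<bar>G p - G q\<bar> \<le> L * \<bar>p - q\<bar>" and "L \<ge> 0"
    and A[measurable]: "A \<in> borel_measurable borel"
    and A_bound: "\<And>x. \<bar>A x\<bar> \<le> B" and A_supp: "\<And>x. x \<notin> {-R..R} \<Longrightarrow> A x = 0" and "R > 0"
  shows "isCont (\<lambda>t. LINT x|lborel. G (v t x) * A x) t"
proof -
  have B0: "B \<ge> 0" using A_bound[of 0] by auto
  have M0: "M \<ge> 0" using bound[of 0 0] by auto
  have int: "integrable lborel (\<lambda>x. G (v s x) * A x)" for s
  proof (rule integrable_bounded_support[where K = "(\<bar>G 0\<bar> + L * M) * B" and a = "-R" and b = R])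
    fix x
    have "\<bar>G (v s x)\<bar> \<le> \<bar>G 0\<bar> + L * M"
    proof -
      have "\<bar>G (v s x) - G 0\<bar> \<le> L * \<bar>v s x\<bar>" using lip[of "v s x" 0] bound[of s x] M0 by simp
      also have "\<dots> \<le> L * M" using bound \<open>L \<ge> 0\<close> by (rule mult_left_mono)
      finally show ?thesis by linarith
    qed
    then show "\<bar>G (v s x) * A x\<bar> \<le> (\<bar>G 0\<bar> + L * M) * B"
      unfolding abs_mult using A_bound by (rule mult_mono) (use M0 \<open>L \<ge> 0\<close> in auto)
  qed (use A_supp in auto)
  have int2: "integrable lborel (\<lambda>x. indicator {-R..R} x * \<bar>v s x - v t x\<bar>)" for s
    by (rule integrable_bounded_support[where K = "2 * M" and a = "-R" and b = R])
      (use bound[of s] bound[of t] M0 in \<open>auto simp: indicator_def intro: order_trans[OF abs_triangle_ineq4] add_mono[of _ M _ M, simplified]\<close>)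
  have le: "\<bar>(LINT x|lborel. G (v s x) * A x) - (LINT x|lborel. G (v t x) * A x)\<bar>
      \<le> L * B * (LINT x:{-R..R}|lborel. \<bar>v s x - v t x\<bar>)" for s
  proof -
    have "\<bar>(LINT x|lborel. G (v s x) * A x) - (LINT x|lborel. G (v t x) * A x)\<bar>
        = \<bar>LINT x|lborel. (G (v s x) - G (v t x)) * A x\<bar>"
      using int[of s] int[of t] by (simp add: left_diff_distrib)
    also have "\<dots> \<le> (LINT x|lborel. \<bar>(G (v s x) - G (v t x)) * A x\<bar>)"
      by (rule integral_abs_bound)
    also have "\<dots> \<le> (LINT x|lborel. L * B * (indicator {-R..R} x * \<bar>v s x - v t x\<bar>))"
    proof (rule integral_mono)
      show "integrable lborel (\<lambda>x. \<bar>(G (v s x) - G (v t x)) * A x\<bar>)"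
        using int[of s] int[of t] by (auto simp: left_diff_distrib)
      show "integrable lborel (\<lambda>x. L * B * (indicator {-R..R} x * \<bar>v s x - v t x\<bar>))"
        using int2 by auto
      fix x
      show "\<bar>(G (v s x) - G (v t x)) * A x\<bar> \<le> L * B * (indicator {-R..R} x * \<bar>v s x - v t x\<bar>)"
      proof (cases "x \<in> {-R..R}")
        case True
        have "\<bar>G (v s x) - G (v t x)\<bar> * \<bar>A x\<bar> \<le> (L * \<bar>v s x - v t x\<bar>) * B"
          by (rule mult_mono) (use lip bound A_bound \<open>L \<ge> 0\<close> in auto)
        then show ?thesis using True by (simp add: abs_mult mult_ac)
      qed (use A_supp in auto)
    qed
    also have "\<dots> = L * B * (LINT x:{-R..R}|lborel. \<bar>v s x - v t x\<bar>)"
      by (simp add: set_lebesgue_integral_def)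
    finally show ?thesis .
  qed
  have "((\<lambda>s. L * B * (LINT x:{-R..R}|lborel. \<bar>v s x - v t x\<bar>)) \<longlongrightarrow> 0) (at t)"
    using tendsto_mult_left[OF cont[OF \<open>R > 0\<close>], of "L * B"] by simp
  then have "((\<lambda>s. (LINT x|lborel. G (v s x) * A x) - (LINT x|lborel. G (v t x) * A x)) \<longlongrightarrow> 0) (at t)"
    by (rule Lim_null_comparison[rotated]) (use le in \<open>auto intro!: always_eventually\<close>)
  then show ?thesis unfolding isCont_def by (simp add: LIM_zero_iff)
qed

section \<open>The conservation law for smooth cutoffs\<close>

text \<open>The last argument is the order of differentiation. The function itself rises from 0 to 1 on
  \<open>[a, a + \<eta>]\<close> and falls back on \<open>[b, b + \<delta>]\<close>; the two scales differ only for cutoffs in time.\<close>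

definition cut :: "real \<Rightarrow> real \<Rightarrow> real \<Rightarrow> real \<Rightarrow> nat \<Rightarrow> real \<Rightarrow> real" where
  "cut \<eta> a \<delta> b n x = (1 / \<delta>) ^ n * sstep n ((x - b) / \<delta>) - (1 / \<eta>) ^ n * sstep n ((x - a) / \<eta>)"

lemma smooth_seq_cut: "smooth_seq (cut \<eta> a \<delta> b)"
proof -
  have "smooth_seq sstep" using smooth_step_sstep by (simp add: smooth_step_def)
  from smooth_seq_diff[OF smooth_seq_affine[OF this] smooth_seq_affine[OF this]]
  show ?thesis unfolding cut_def[abs_def] .
qed

lemma cut_measurable [measurable]: "cut \<eta> a \<delta> b n \<in> borel_measurable borel"
  unfolding cut_def[abs_def] by measurable

lemma cut_bounded: "\<exists>B\<ge>0. \<forall>x. \<bar>cut \<eta> a \<delta> b n x\<bar> \<le> B"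
proof -
  obtain B where B: "\<And>x. \<bar>sstep n x\<bar> \<le> B" using sstep_bounded[of n] by auto
  have "\<bar>cut \<eta> a \<delta> b n x\<bar> \<le> \<bar>(1 / \<delta>) ^ n\<bar> * B + \<bar>(1 / \<eta>) ^ n\<bar> * B" for x
    unfolding cut_def
    by (rule order_trans[OF abs_triangle_ineq4], unfold abs_mult, intro add_mono mult_left_mono B) auto
  then show ?thesis using B[of 0] by (intro exI[of _ "\<bar>(1 / \<delta>) ^ n\<bar> * B + \<bar>(1 / \<eta>) ^ n\<bar> * B"]) auto
qed

text \<open>Both orders of \<open>a\<close> and \<open>b\<close> are covered. With equal scales,
  exchanging \<open>a\<close> and \<open>b\<close> changes the sign of the cutoff, so integrals
  against it behave like oriented integrals.\<close>

lemma cut_out: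
  assumes "\<eta> > 0" "\<delta> > 0" "x \<le> min a b \<or> x \<ge> max (a + \<eta>) (b + \<delta>)"
  shows "cut \<eta> a \<delta> b n x = 0"
proof -
  have "((x - b) / \<delta> \<le> 0 \<and> (x - a) / \<eta> \<le> 0) \<or> ((x - b) / \<delta> \<ge> 1 \<and> (x - a) / \<eta> \<ge> 1)"
    using assms by (auto simp: divide_le_0_iff le_divide_eq)
  then show ?thesis
    by (cases n) (auto simp: cut_def sstep_left sstep_right sstep_out)
qed

text \<open>Continuity is available at positive times; the half-open interval omits 0, so
  \<open>a = 0\<close> is admissible.\<close>

lemma set_integrable_Ioc:
  fixes g :: "real \<Rightarrow> real"
  assumes "\<And>s. s > 0 \<Longrightarrow> isCont g s" "\<And>s. \<bar>g s\<bar> \<le> K" "0 \<le> a"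
  shows "set_integrable lborel {a<..b} g"
  unfolding set_integrable_def
proof (rule integrable_bounded_support[where K = K and a = a and b = b])
  have "continuous_on {0<..} g"
    using assms(1) by (intro continuous_at_imp_continuous_on) auto
  then have [measurable]: "(\<lambda>s. indicator {0<..} s *\<^sub>R g s) \<in> borel_measurable borel"
    by (intro borel_measurable_continuous_on_indicator) auto
  have "(\<lambda>s. indicat_real {a<..b} s * (indicator {0<..} s *\<^sub>R g s)) \<in> borel_measurable lborel"
    by measurable
  also have "(\<lambda>s. indicat_real {a<..b} s * (indicator {0<..} s *\<^sub>R g s)) = (\<lambda>s. indicat_real {a<..b} s *\<^sub>R g s)"
    using \<open>0 \<le> a\<close> by (auto simp: indicator_def)
  finally show "(\<lambda>s. indicat_real {a<..b} s *\<^sub>R g s) \<in> borel_measurable lborel" .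
  have "K \<ge> 0" using assms(2)[of 0] by linarith
  then show "\<bar>indicat_real {a<..b} s *\<^sub>R g s\<bar> \<le> K" for s
    using assms(2)[of s] by (simp add: indicator_def)
qed auto

text \<open>\<open>weak\<close> says that \<open>h\<close> has weak derivative \<open>k\<close> and
  initial value \<open>h0\<close>. The time cutoff is 1 up to \<open>t - \<eta>\<close> and 0 from
  \<open>t\<close> on, so minus its derivative is a unit mass concentrated just before
  \<open>t\<close>. As \<eta> tends to 0, continuity of \<open>h\<close> yields \<open>h t\<close>,
  and boundedness of \<open>k\<close> makes the transition layer negligible.\<close>

lemma integrated_weak_derivative:
  fixes h k :: "real \<Rightarrow> real"
  assumes h: "\<And>s. s > 0 \<Longrightarrow> isCont h s" and k: "\<And>s. s > 0 \<Longrightarrow> isCont k s"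
    and K: "\<And>s. \<bar>k s\<bar> \<le> K"
    and weak: "\<And>t \<eta>. 0 < \<eta> \<Longrightarrow> \<eta> < t \<Longrightarrow>
      (LINT s|lborel. indicator {0<..} s *
         (cut 1 (-2) \<eta> (t - \<eta>) 1 s * h s + cut 1 (-2) \<eta> (t - \<eta>) 0 s * k s)) + h0 = 0"
    and "t > 0"
  shows "h t = h0 + (LINT s:{0<..t}|lborel. k s)"
proof -
  have K0: "K \<ge> 0" using K[of 0] by auto
  define I where "I = (LINT s:{0<..t}|lborel. k s)"
  have kI_int: "integrable lborel (\<lambda>s. indicator {0<..t} s * k s)"
    using set_integrable_Ioc[OF k K, of 0 t] by (simp add: set_integrable_def)
  have "\<bar>h t - (h0 + I)\<bar> \<le> e" if "e > 0" for e
  proof -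
    define e' where "e' = e / 2"
    have "e' > 0" using that by (simp add: e'_def)
    obtain d where d: "d > 0" "\<And>s. dist s t < d \<Longrightarrow> dist (h s) (h t) < e'"
      using h[OF \<open>t > 0\<close>] \<open>e' > 0\<close> unfolding continuous_at_eps_delta by (metis dist_norm real_norm_def)
    \<comment> \<open>The three bounds keep the layer inside the continuity neighbourhood of
      \<open>t\<close>, at positive times, and so short that \<open>k\<close> contributes at most
      \<open>e'\<close> on it.\<close>
    define \<eta> where "\<eta> = min (d / 2) (min (t / 2) (e' / (K + 1)))"
    have "e' / (K + 1) > 0" using \<open>e' > 0\<close> K0 by simp
    then have \<eta>: "\<eta> > 0" "\<eta> < d" "\<eta> < t" using d(1) \<open>t > 0\<close> by (auto simp: \<eta>_def)
    have "K * \<eta> \<le> K * (e' / (K + 1))" using K0 by (intro mult_left_mono) (auto simp: \<eta>_def)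
    also have "\<dots> \<le> e'" using K0 \<open>e' > 0\<close> by (simp add: field_simps)
    finally have K\<eta>: "K * \<eta> \<le> e'" .
    define m where "m s = - (sstep 1 ((s - (t - \<eta>)) / \<eta>) / \<eta>)" for s
    define X where "X s = sstep 0 ((s - (t - \<eta>)) / \<eta>)" for s
    \<comment> \<open>The rising flank lies in \<open>[-2, -1]\<close> and is invisible at positive
      times; its place and scale are arbitrary.\<close>
    have cut: "cut 1 (-2) \<eta> (t - \<eta>) 1 s = - m s" "cut 1 (-2) \<eta> (t - \<eta>) 0 s = X s" if "s > 0" for s
      using that sstep_out[of "s + 2" 0] by (auto simp: cut_def m_def X_def sstep_right)
    have m_out: "m s = 0" if "s \<notin> {t - \<eta>..t}" for s
    proof -
      have "(s - (t - \<eta>)) / \<eta> \<le> 0 \<or> (s - (t - \<eta>)) / \<eta> \<ge> 1"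
        using that \<eta> by (auto simp: divide_le_0_iff le_divide_eq)
      then show ?thesis using sstep_out[of _ 0] by (auto simp: m_def)
    qed
    have m_pos: "m s \<ge> 0" for s
      using sstep_1_nonpos[of "(s - (t - \<eta>)) / \<eta>"] \<eta> by (simp add: m_def divide_nonpos_pos)
    have m_cont: "continuous_on A m" for A
      unfolding m_def by (intro continuous_intros) (use \<eta> in auto)
    have X_left: "X s = 1" if "s \<le> t - \<eta>" for s
      using that \<eta> by (auto simp: X_def divide_le_0_iff intro!: sstep_left)
    have X_right: "X s = 0" if "s \<ge> t" for s
      using that \<eta> by (auto simp: X_def le_divide_eq intro!: sstep_right)
    have X_meas[measurable]: "X \<in> borel_measurable borel" unfolding X_def by measurable
    have X_range: "0 \<le> X s" "X s \<le> 1" for s using sstep_range by (auto simp: X_def)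
    have int_on: "integrable lborel (\<lambda>s. g s * m s)" if "continuous_on {t - \<eta>..t} g" for g
    proof -
      have "set_integrable lborel {t - \<eta>..t} (\<lambda>s. g s * m s)"
        by (intro borel_integrable_atLeastAtMost' continuous_intros that m_cont)
      moreover have "indicator {t - \<eta>..t} s *\<^sub>R (g s * m s) = g s * m s" for s
        using m_out[of s] by (cases "s \<in> {t - \<eta>..t}") auto
      ultimately show ?thesis by (simp only: set_integrable_def)
    qed
    have hm_cont: "continuous_on {t - \<eta>..t} h"
      using h \<eta> by (intro continuous_at_imp_continuous_on) auto
    have m1: "(LINT s|lborel. m s) = 1"
    proof -
      have "(LINT s|lborel. m s * indicator {t - \<eta>..t} s)
          = - sstep 0 ((t - (t - \<eta>)) / \<eta>) - - sstep 0 ((t - \<eta> - (t - \<eta>)) / \<eta>)"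
      proof (rule integral_FTC_Icc_real)
        fix s
        have i: "((\<lambda>s. (s - (t - \<eta>)) / \<eta>) has_real_derivative 1 / \<eta>) (at s)"
          by (rule DERIV_cong[OF DERIV_cdivide[OF DERIV_diff[OF DERIV_ident DERIV_const]]]) simp
        show "((\<lambda>s. - sstep 0 ((s - (t - \<eta>)) / \<eta>)) has_real_derivative m s) (at s)"
          by (rule DERIV_cong[OF DERIV_minus[OF DERIV_chain2[OF sstep_DERIV i]]]) (simp add: m_def)
        show "isCont m s" using m_cont[of UNIV] by (simp add: continuous_on_eq_continuous_at)
      qed (use \<eta> in auto)
      moreover have "m s * indicator {t - \<eta>..t} s = m s" for s
        using m_out[of s] by (cases "s \<in> {t - \<eta>..t}") auto
      ultimately have "(LINT s|lborel. m s)
          = - sstep 0 ((t - (t - \<eta>)) / \<eta>) - - sstep 0 ((t - \<eta> - (t - \<eta>)) / \<eta>)"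
        by (simp only:)
      then show ?thesis using \<eta> by (simp add: sstep_left sstep_right)
    qed
    have XkI: "integrable lborel (\<lambda>s. X s * (indicator {0<..t} s * k s))"
      by (rule Bochner_Integration.integrable_bound[OF kI_int])
        (use X_range kI_int in \<open>auto simp: abs_mult intro!: mult_left_le_one_le\<close>)
    have w: "indicator {0<..} s * (cut 1 (-2) \<eta> (t - \<eta>) 1 s * h s + cut 1 (-2) \<eta> (t - \<eta>) 0 s * k s)
      = X s * (indicator {0<..t} s * k s) - h s * m s" for s
      using cut[of s] m_out[of s] X_right[of s] \<eta> by (auto simp: indicator_def)
    have lim0: "(LINT s|lborel. X s * (indicator {0<..t} s * k s)) - (LINT s|lborel. h s * m s) + h0 = 0"
      using weak[OF \<eta>(1,3)] XkI int_on[OF hm_cont] unfolding w by simp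
    have lim1: "\<bar>(LINT s|lborel. h s * m s) - h t\<bar> \<le> e'"
    proof -
      have "(LINT s|lborel. h s * m s) - h t = (LINT s|lborel. (h s - h t) * m s)"
        using int_on[OF hm_cont] int_on[of "\<lambda>_. h t"] m1 by (simp add: left_diff_distrib)
      also have "\<bar>\<dots>\<bar> \<le> (LINT s|lborel. \<bar>(h s - h t) * m s\<bar>)" by (rule integral_abs_bound)
      also have "\<dots> \<le> (LINT s|lborel. e' * m s)"
      proof (rule integral_mono)
        show "integrable lborel (\<lambda>s. \<bar>(h s - h t) * m s\<bar>)"
          by (intro integrable_abs int_on continuous_intros hm_cont)
        show "integrable lborel (\<lambda>s. e' * m s)" by (intro int_on continuous_intros)
        show "\<bar>(h s - h t) * m s\<bar> \<le> e' * m s" for s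
        proof (cases "s \<in> {t - \<eta>..t}")
          case True
          then have "\<bar>h s - h t\<bar> \<le> e'" using d(2)[of s] \<eta> by (auto simp: dist_real_def)
          then show ?thesis using m_pos[of s] by (simp add: abs_mult mult_right_mono)
        qed (simp add: m_out)
      qed
      also have "\<dots> = e'" using m1 by simp
      finally show ?thesis .
    qed
    have lim2: "\<bar>(LINT s|lborel. X s * (indicator {0<..t} s * k s)) - I\<bar> \<le> e'"
    proof -
      have "(LINT s|lborel. X s * (indicator {0<..t} s * k s)) - I
          = (LINT s|lborel. (X s - 1) * (indicator {0<..t} s * k s))"
        using XkI kI_int by (simp add: I_def set_lebesgue_integral_def left_diff_distrib)
      also have "\<bar>\<dots>\<bar> \<le> (LINT s|lborel. \<bar>(X s - 1) * (indicator {0<..t} s * k s)\<bar>)"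
        by (rule integral_abs_bound)
      also have "\<dots> \<le> (LINT s|lborel. K * indicator {t - \<eta>..t} s)"
      proof (rule integral_mono)
        show "integrable lborel (\<lambda>s. \<bar>(X s - 1) * (indicator {0<..t} s * k s)\<bar>)"
          using XkI kI_int by (simp add: left_diff_distrib)
        show "integrable lborel (\<lambda>s. K * indicator {t - \<eta>..t} s)"
          by (intro integrable_mult_right) (simp add: integrable_indicator_iff emeasure_lborel_Icc_eq)
        fix s
        have "\<bar>X s - 1\<bar> * \<bar>k s\<bar> \<le> 1 * K"
          using X_range[of s] K by (intro mult_mono) auto
        then show "\<bar>(X s - 1) * (indicator {0<..t} s * k s)\<bar> \<le> K * indicator {t - \<eta>..t} s"
          using X_left[of s] K0 by (auto simp: indicator_def abs_mult)
      qed
      also have "\<dots> = K * \<eta>" using \<eta> by simp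
      finally show ?thesis using K\<eta> by simp
    qed
    show ?thesis using lim0 lim1 lim2 unfolding e'_def by linarith
  qed
  then have "\<bar>h t - (h0 + I)\<bar> \<le> 0" using field_le_epsilon[of "\<bar>h t - (h0 + I)\<bar>" 0] by simp
  then show ?thesis by (simp add: I_def)
qed

section \<open>Product test functions and the weak formulation on slices\<close>

lemma test_function_product:
  assumes A: "smooth_seq A" and B: "smooth_seq B"
    and A_supp: "\<And>x. x \<notin> {-R..R} \<Longrightarrow> A 0 x = 0" and B_supp: "\<And>t. t \<notin> {-R..R} \<Longrightarrow> B 0 t = 0"
  shows "test_function (\<lambda>z. A 0 (fst z) * B 0 (snd z))"
  unfolding test_function_def
proof (intro conjI allI impI exI[of _ "{-R..R} \<times> {-R..R}"])
  show "Ck k (\<lambda>z. A 0 (fst z) * B 0 (snd z))" for k using A B by (rule Ck_product)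
next
  fix z assume "z \<notin> {-R..R} \<times> {-R..R}"
  then have "fst z \<notin> {-R..R} \<or> snd z \<notin> {-R..R}" by (cases z) auto
  then show "A 0 (fst z) * B 0 (snd z) = 0" using A_supp B_supp by auto
qed (auto intro: compact_Times)

lemma weak_solution_product:
  assumes u: "weak_solution f u0 u" and A: "smooth_seq A" and B: "smooth_seq B"
    and A_supp: "\<And>x. x \<notin> {-R..R} \<Longrightarrow> A 0 x = 0" and B_supp: "\<And>t. t \<notin> {-R..R} \<Longrightarrow> B 0 t = 0"
  shows "(LINT z|lebesgue. indicator (UNIV \<times> {0<..}) z *
      (u (fst z) (snd z) * (A 0 (fst z) * B 1 (snd z)) + f (u (fst z) (snd z)) * (A 1 (fst z) * B 0 (snd z))))
    + (LINT x|lebesgue. u0 x * A 0 x) * B 0 0 = 0"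
proof -
  have dA: "deriv (A 0) x = A 1 x" and dB: "deriv (B 0) x = B 1 x" for x
    using A B by (auto simp: smooth_seq_def intro!: DERIV_imp_deriv)
  have fA: "A 0 field_differentiable at x" and fB: "B 0 field_differentiable at x" for x
    using A B unfolding smooth_seq_def field_differentiable_def by blast+
  have "deriv (\<lambda>s. A 0 x * B 0 s) t = A 0 x * B 1 t" and "deriv (\<lambda>y. A 0 y * B 0 t) x = A 1 x * B 0 t" for x t
    using fA fB by (simp_all add: dA dB)
  then show ?thesis
    using u[unfolded weak_solution_def, rule_format, OF test_function_product[OF A B A_supp B_supp]]
    by (simp add: set_lebesgue_integral_def case_prod_beta mult.assoc[symmetric])
qed

text \<open>The representatives \<open>v t\<close> are chosen for each time separately, so no joint
  measurability of \<open>v\<close> is at hand. Fubini is therefore applied to \<open>u\<close>, and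
  \<open>v\<close> enters after integration in \<open>x\<close>.\<close>

locale slices =
  fixes f :: "real \<Rightarrow> real" and u0 :: "real \<Rightarrow> real" and u :: "real \<Rightarrow> real \<Rightarrow> real"
    and v :: "real \<Rightarrow> real \<Rightarrow> real" and M L :: real
  assumes weak: "weak_solution f u0 u"
    and u_meas: "(\<lambda>(x, t). u x t) \<in> borel_measurable (lebesgue_on (UNIV \<times> {0<..}))"
    and u_bound: "AE z in lebesgue_on (UNIV \<times> {0<..}). \<bar>(\<lambda>(x, t). u x t) z\<bar> \<le> M"
    and u_slice_meas: "\<And>t. t > 0 \<Longrightarrow> (\<lambda>x. u x t) \<in> borel_measurable lebesgue"
    and v_meas [measurable]: "\<And>t. v t \<in> borel_measurable borel"
    and v_bound: "\<And>t x. \<bar>v t x\<bar> \<le> M"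
    and u_eq_v: "\<And>t. t > 0 \<Longrightarrow> AE x in lebesgue. u x t = v t x"
    and time_cont: "time_continuous u"
    and f_meas [measurable]: "f \<in> borel_measurable borel"
    and lip: "\<And>p q. \<bar>p\<bar> \<le> M \<Longrightarrow> \<bar>q\<bar> \<le> M \<Longrightarrow> \<bar>f p - f q\<bar> \<le> L * \<bar>p - q\<bar>"
    and L_nonneg: "L \<ge> 0"
begin

lemma M_nonneg: "M \<ge> 0" using v_bound[of 0 0] by linarith

lemma f_bound: "\<bar>p\<bar> \<le> M \<Longrightarrow> \<bar>f p\<bar> \<le> \<bar>f 0\<bar> + L * M"
proof -
  assume p: "\<bar>p\<bar> \<le> M"
  have "\<bar>f p - f 0\<bar> \<le> L * \<bar>p\<bar>" using lip[OF p, of 0] M_nonneg by simp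
  also have "\<dots> \<le> L * M" using p L_nonneg by (rule mult_left_mono)
  finally show ?thesis by linarith
qed

lemma v_time_cont:
  assumes "t > 0" "R > 0"
  shows "((\<lambda>s. LINT x:{-R..R}|lborel. \<bar>v s x - v t x\<bar>) \<longlongrightarrow> 0) (at t)"
proof (rule Lim_transform_eventually)
  show "((\<lambda>s. LINT x:{-R..R}|lebesgue. \<bar>u x s - u x t\<bar>) \<longlongrightarrow> 0) (at t)"
    using time_cont assms by (simp add: time_continuous_def)
  have "eventually (\<lambda>s. s > 0) (at t)"
    using assms(1) by (metis eventually_at_topological greaterThan_iff open_greaterThan)
  then show "\<forall>\<^sub>F s in at t. (LINT x:{-R..R}|lebesgue. \<bar>u x s - u x t\<bar>) = (LINT x:{-R..R}|lborel. \<bar>v s x - v t x\<bar>)"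
  proof eventually_elim
    case (elim s)
    have "(LINT x:{-R..R}|lborel. \<bar>v s x - v t x\<bar>) = (LINT x:{-R..R}|lebesgue. \<bar>v s x - v t x\<bar>)"
      unfolding set_lebesgue_integral_def by (subst integral_completion) auto
    also have "\<dots> = (LINT x:{-R..R}|lebesgue. \<bar>u x s - u x t\<bar>)"
      unfolding set_lebesgue_integral_def
    proof (rule integral_cong_AE)
      note [measurable] = u_slice_meas[OF elim] u_slice_meas[OF assms(1)]
      have [measurable]: "v s \<in> borel_measurable lebesgue" "v t \<in> borel_measurable lebesgue"
        using v_meas by (auto intro: measurable_completion)
      have [measurable]: "(\<lambda>x. indicat_real {-R..R} x) \<in> borel_measurable lebesgue"
        by (intro borel_measurable_indicator) auto
      show "(\<lambda>x. indicat_real {- R..R} x *\<^sub>R \<bar>v s x - v t x\<bar>) \<in> borel_measurable lebesgue"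
        and "(\<lambda>x. indicat_real {- R..R} x *\<^sub>R \<bar>u x s - u x t\<bar>) \<in> borel_measurable lebesgue"
        by measurable
      show "AE x in lebesgue. indicat_real {- R..R} x *\<^sub>R \<bar>v s x - v t x\<bar> = indicat_real {- R..R} x *\<^sub>R \<bar>u x s - u x t\<bar>"
        using u_eq_v[OF elim] u_eq_v[OF assms(1)] by eventually_elim simp
    qed
    finally show ?case by simp
  qed
qed

lemma slice_integral_eq:
  assumes "t > 0" and [measurable]: "A \<in> borel_measurable borel" "A' \<in> borel_measurable borel"
    and bound: "\<And>x. \<bar>A x\<bar> \<le> K" "\<And>x. \<bar>A' x\<bar> \<le> K" 
    and supp: "\<And>x. x \<notin> {-R..R} \<Longrightarrow> A x = 0" "\<And>x. x \<notin> {-R..R} \<Longrightarrow> A' x = 0"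
  shows "(LINT x|lebesgue. u x t * (A x * b) + f (u x t) * (A' x * b'))
    = b * (LINT x|lborel. v t x * A x) + b' * (LINT x|lborel. f (v t x) * A' x)"
proof -
  have K: "K \<ge> 0" using bound(1)[of 0] by linarith
  have "(LINT x|lebesgue. u x t * (A x * b) + f (u x t) * (A' x * b'))
      = (LINT x|lebesgue. v t x * (A x * b) + f (v t x) * (A' x * b'))"
  proof (rule integral_cong_AE)
    note [measurable] = u_slice_meas[OF assms(1)]
    have [measurable]: "A \<in> borel_measurable lebesgue" "A' \<in> borel_measurable lebesgue" "v t \<in> borel_measurable lebesgue"
      using assms(2,3) v_meas by (auto intro: measurable_completion)
    show "(\<lambda>x. u x t * (A x * b) + f (u x t) * (A' x * b')) \<in> borel_measurable lebesgue"
      and "(\<lambda>x. v t x * (A x * b) + f (v t x) * (A' x * b')) \<in> borel_measurable lebesgue"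
      by measurable
    show "AE x in lebesgue. u x t * (A x * b) + f (u x t) * (A' x * b') = v t x * (A x * b) + f (v t x) * (A' x * b')"
      using u_eq_v[OF assms(1)] by eventually_elim simp
  qed
  also have "\<dots> = (LINT x|lborel. v t x * (A x * b) + f (v t x) * (A' x * b'))"
    by (rule integral_completion) simp
  also have "\<dots> = (LINT x|lborel. b * (v t x * A x) + b' * (f (v t x) * A' x))"
    by (simp add: algebra_simps)
  also have "\<dots> = b * (LINT x|lborel. v t x * A x) + b' * (LINT x|lborel. f (v t x) * A' x)"
  proof -
    have "integrable lborel (\<lambda>x. v t x * A x)"
      by (rule integrable_bounded_support[where K = "M * K" and a = "-R" and b = R])
        (use supp M_nonneg in \<open>auto simp: abs_mult intro!: mult_mono v_bound bound\<close>)
    moreover have "integrable lborel (\<lambda>x. f (v t x) * A' x)"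
      by (rule integrable_bounded_support[where K = "(\<bar>f 0\<bar> + L * M) * K" and a = "-R" and b = R])
        (use supp M_nonneg L_nonneg in \<open>auto simp: abs_mult intro!: mult_mono f_bound v_bound bound\<close>)
    ultimately show ?thesis by simp
  qed
  finally show ?thesis .
qed

text \<open>Testing with \<open>A 0 x * B 0 t\<close> and integrating in \<open>x\<close> leaves an
  identity in time for \<open>h\<close>, the integral of \<open>v t\<close> against
  \<open>A 0\<close>, and \<open>k\<close>, the flux tested against \<open>A 1\<close>. It says that
  \<open>k\<close> is the weak derivative of \<open>h\<close>.\<close>

lemma conservation_law:
  assumes A: "smooth_seq A" and A_bound: "\<And>x. \<bar>A 0 x\<bar> \<le> K" "\<And>x. \<bar>A 1 x\<bar> \<le> K"
    and supp: "\<And>x. x \<notin> {-R..R} \<Longrightarrow> A 0 x = 0" "\<And>x. x \<notin> {-R..R} \<Longrightarrow> A 1 x = 0"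
    and "R > 0" "t > 0"
  shows "(LINT x|lborel. v t x * A 0 x) = (LINT x|lebesgue. u0 x * A 0 x)
      + (LINT s:{0<..t}|lborel. LINT x|lborel. f (v s x) * A 1 x)"
proof -
  have K0: "K \<ge> 0" using A_bound(1)[of 0] by linarith
  have A_cont: "continuous_on UNIV (A n)" for n
    using A DERIV_isCont unfolding smooth_seq_def by (blast intro!: continuous_at_imp_continuous_on)
  have A_meas[measurable]: "A n \<in> borel_measurable borel" for n
    using A_cont by (rule borel_measurable_continuous_onI)
  define h where "h t = (LINT x|lborel. v t x * A 0 x)" for t
  define k where "k t = (LINT x|lborel. f (v t x) * A 1 x)" for t
  have h_cont: "isCont h t" if "t > 0" for t
    unfolding h_def
    using isCont_slice_integral[OF v_meas v_bound v_time_cont[OF that], of "\<lambda>p. p" 1 "A 0" K R]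
      A_bound supp \<open>R > 0\<close> by simp
  have k_cont: "isCont k t" if "t > 0" for t
    unfolding k_def
    by (rule isCont_slice_integral[OF v_meas v_bound v_time_cont[OF that] f_meas lip L_nonneg A_meas
        A_bound(2) supp(2) \<open>R > 0\<close>]) auto
  have k_bound: "\<bar>k s\<bar> \<le> (\<bar>f 0\<bar> + L * M) * K * (2 * R)" for s
  proof -
    have b: "\<bar>f (v s x) * A 1 x\<bar> \<le> (\<bar>f 0\<bar> + L * M) * K * indicator {-R..R} x" for x
    proof (cases "x \<in> {-R..R}")
      case True
      have "\<bar>f (v s x)\<bar> * \<bar>A 1 x\<bar> \<le> (\<bar>f 0\<bar> + L * M) * K"
        by (intro mult_mono f_bound v_bound A_bound) (use M_nonneg L_nonneg in auto)
      then show ?thesis using True by (simp add: abs_mult)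
    qed (use supp in simp)
    have "\<bar>k s\<bar> \<le> (LINT x|lborel. \<bar>f (v s x) * A 1 x\<bar>)"
      unfolding k_def by (rule integral_abs_bound)
    also have "\<dots> \<le> (LINT x|lborel. (\<bar>f 0\<bar> + L * M) * K * indicator {-R..R} x)"
    proof (rule integral_mono[OF _ _ b])
      show "integrable lborel (\<lambda>x. (\<bar>f 0\<bar> + L * M) * K * indicator {-R..R} x)"
        by (intro integrable_mult_right) (simp add: integrable_indicator_iff emeasure_lborel_Icc_eq)
      then show "integrable lborel (\<lambda>x. \<bar>f (v s x) * A 1 x\<bar>)"
        by (rule Bochner_Integration.integrable_bound)
          (auto intro!: AE_I2 order_trans[OF b[unfolded One_nat_def] abs_ge_self])
    qed
    also have "\<dots> = (\<bar>f 0\<bar> + L * M) * K * (2 * R)" using \<open>R > 0\<close> by simp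
    finally show ?thesis .
  qed
  have "h t = (LINT x|lebesgue. u0 x * A 0 x) + (LINT s:{0<..t}|lborel. k s)"
  proof (rule integrated_weak_derivative[OF h_cont k_cont k_bound _ \<open>t > 0\<close>])
    fix t \<eta> :: real assume \<eta>: "0 < \<eta>" "\<eta> < t"
    define B where "B = cut 1 (-2) \<eta> (t - \<eta>)"
    have B: "smooth_seq B" unfolding B_def by (rule smooth_seq_cut)
    have [measurable]: "B n \<in> borel_measurable borel" for n unfolding B_def by measurable
    have B_supp: "s \<notin> {- max 2 t..max 2 t} \<Longrightarrow> B n s = 0" for s n
      unfolding B_def by (rule cut_out) (use \<eta> in auto)
    obtain KB where KB: "\<And>s. \<bar>B 0 s\<bar> \<le> KB" "\<And>s. \<bar>B 1 s\<bar> \<le> KB"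
    proof -
      obtain K1 K2 where "\<forall>s. \<bar>B 0 s\<bar> \<le> K1" "\<forall>s. \<bar>B 1 s\<bar> \<le> K2"
        unfolding B_def using cut_bounded by meson
      then show ?thesis using that[of "max K1 K2"] by (auto simp: le_max_iff_disj)
    qed
    \<comment> \<open>Thus the initial datum enters with weight one.\<close>
    have B00: "B 0 0 = 1" using \<eta> by (simp add: B_def cut_def sstep_left sstep_right divide_le_0_iff)
    define R' where "R' = max R (max 2 t)"
    define \<Phi> where "\<Phi> z = indicator (UNIV \<times> {0<..}) z *
      (u (fst z) (snd z) * (A 0 (fst z) * B 1 (snd z)) + f (u (fst z) (snd z)) * (A 1 (fst z) * B 0 (snd z)))"
      for z :: "real \<times> real"
    have "(LINT z|lebesgue. \<Phi> z) + (LINT x|lebesgue. u0 x * A 0 x) = 0"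
      using weak_solution_product[OF weak A B, of R'] supp(1) B_supp[of _ 0] B00
      unfolding \<Phi>_def R'_def by force
    moreover have inner: "(LINT x|lebesgue. \<Phi> (x, s)) = indicator {0<..} s * (B 1 s * h s + B 0 s * k s)" for s
    proof (cases "s > 0")
      case True
      then show ?thesis
        using slice_integral_eq[OF True A_meas A_meas A_bound supp, where b = "B 1 s" and b' = "B 0 s"]
        by (simp add: \<Phi>_def h_def k_def)
    qed (simp add: \<Phi>_def)
    \<comment> \<open>Measurability in time comes from the continuity of \<open>h\<close> and
      \<open>k\<close> at positive times.\<close>
    have inner_meas: "(\<lambda>s. indicator {0<..} s * (B 1 s * h s + B 0 s * k s)) \<in> borel_measurable borel"
    proof -
      have "continuous_on UNIV (B n)" for n
        using B DERIV_isCont unfolding smooth_seq_def by (blast intro!: continuous_at_imp_continuous_on)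
      then have c: "continuous_on {0<..} (\<lambda>s. B 1 s * h s + B 0 s * k s)"
        by (intro continuous_intros) (auto intro: continuous_on_subset continuous_at_imp_continuous_on h_cont k_cont)
      then show ?thesis
        using borel_measurable_continuous_on_indicator[OF _ c] by simp
    qed
    have "(LINT z|lebesgue. \<Phi> z) = (LINT s|lebesgue. LINT x|lebesgue. \<Phi> (x, s))"
    proof (rule integral_lebesgue_prod)
      show "(\<lambda>s. LINT x|lebesgue. \<Phi> (x, s)) \<in> borel_measurable lebesgue"
        unfolding inner using inner_meas by (simp add: measurable_completion)
      show "(\<lambda>x. \<Phi> (x, s)) \<in> borel_measurable lebesgue" for s
      proof (cases "s > 0")
        case True
        note [measurable] = u_slice_meas[OF True]
        have [measurable]: "A n \<in> borel_measurable lebesgue" for n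
          using A_meas by (auto intro: measurable_completion)
        show ?thesis using True unfolding \<Phi>_def by (simp add: indicator_times)
      qed (simp add: \<Phi>_def)
      let ?\<Omega> = "UNIV \<times> {0<..} :: (real \<times> real) set"
      have \<Omega>: "?\<Omega> \<in> sets lebesgue"
        by (intro sets_completionI_sets) (simp add: borel_open open_Times)
      show "integrable lebesgue \<Phi>"
      proof (rule integrableI_bounded_set[where A = "{-R'..R'} \<times> {-R'..R'}" and B = "M * (K * KB) + (\<bar>f 0\<bar> + L * M) * (K * KB)"])
        have "{-R'..R'} \<times> {-R'..R'} = cbox (-R', -R') (R', R')" by (auto simp: cbox_Pair_eq)
        then show "{-R'..R'} \<times> {-R'..R'} \<in> sets lebesgue" "emeasure lebesgue ({-R'..R'} \<times> {-R'..R'}) < \<infinity>"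
          by (auto simp: emeasure_lborel_cbox_eq)
        show "\<Phi> \<in> borel_measurable lebesgue"
        proof -
          have [measurable]: "(\<lambda>z. u (fst z) (snd z)) \<in> borel_measurable (lebesgue_on ?\<Omega>)"
            using u_meas by (simp add: case_prod_beta')
          have [measurable]: "(\<lambda>z. g (fst z)) \<in> borel_measurable (lebesgue_on ?\<Omega>)"
            "(\<lambda>z. g (snd z)) \<in> borel_measurable (lebesgue_on ?\<Omega>)" if "g \<in> borel_measurable borel" for g :: "real \<Rightarrow> real"
          proof -
            have "(\<lambda>z. fst z) \<in> borel_measurable lborel" "(\<lambda>z. snd z) \<in> borel_measurable lborel"
              by (auto intro!: borel_measurable_continuous_onI continuous_intros)
            from measurable_compose[OF this(1) that] measurable_compose[OF this(2) that]
            have "(\<lambda>z. g (fst z)) \<in> borel_measurable lborel" "(\<lambda>z. g (snd z)) \<in> borel_measurable lborel" .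
            then show "(\<lambda>z. g (fst z)) \<in> borel_measurable (lebesgue_on ?\<Omega>)"
              "(\<lambda>z. g (snd z)) \<in> borel_measurable (lebesgue_on ?\<Omega>)"
              by (auto intro!: measurable_restrict_space1 measurable_completion)
          qed
          have "(\<lambda>z. u (fst z) (snd z) * (A 0 (fst z) * B 1 (snd z)) + f (u (fst z) (snd z)) * (A 1 (fst z) * B 0 (snd z)))
            \<in> borel_measurable (lebesgue_on ?\<Omega>)"
            by measurable
          then show ?thesis
            unfolding \<Phi>_def using \<Omega> by (subst (asm) borel_measurable_restrict_space_iff) auto
        qed
        have "AE z in lebesgue. z \<in> ?\<Omega> \<longrightarrow> \<bar>u (fst z) (snd z)\<bar> \<le> M"
          using u_bound \<Omega> by (subst (asm) AE_restrict_space_iff) (auto simp: case_prod_beta')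
        then show "AE z\<in>{-R'..R'} \<times> {-R'..R'} in lebesgue. norm (\<Phi> z) \<le> M * (K * KB) + (\<bar>f 0\<bar> + L * M) * (K * KB)"
        proof eventually_elim
          case (elim z)
          have nn: "KB \<ge> 0" using KB(1)[of 0] by linarith
          have p: "0 \<le> M * (K * KB)" "0 \<le> (\<bar>f 0\<bar> + L * M) * (K * KB)"
            using nn K0 M_nonneg L_nonneg by auto
          show ?case
          proof (cases "z \<in> ?\<Omega>")
            case True
            then have b: "\<bar>u (fst z) (snd z)\<bar> \<le> M" using elim by simp
            have "\<bar>u (fst z) (snd z) * (A 0 (fst z) * B 1 (snd z))\<bar> \<le> M * (K * KB)"
              unfolding abs_mult by (intro mult_mono b A_bound KB) (use K0 nn M_nonneg in auto)
            moreover have "\<bar>f (u (fst z) (snd z)) * (A 1 (fst z) * B 0 (snd z))\<bar> \<le> (\<bar>f 0\<bar> + L * M) * (K * KB)"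
              unfolding abs_mult by (intro mult_mono f_bound b A_bound KB) (use K0 nn M_nonneg L_nonneg in auto)
            ultimately have "\<bar>u (fst z) (snd z) * (A 0 (fst z) * B 1 (snd z)) + f (u (fst z) (snd z)) * (A 1 (fst z) * B 0 (snd z))\<bar>
                \<le> M * (K * KB) + (\<bar>f 0\<bar> + L * M) * (K * KB)"
              by (rule order_trans[OF abs_triangle_ineq add_mono])
            then show ?thesis using True by (simp add: \<Phi>_def)
          qed (use p in \<open>simp add: \<Phi>_def\<close>)
        qed
        show "AE z in lebesgue. z \<notin> {-R'..R'} \<times> {-R'..R'} \<longrightarrow> \<Phi> z = 0"
        proof (intro AE_I2 impI)
          fix z assume "z \<notin> {-R'..R'} \<times> {-R'..R'}"
          then have "fst z \<notin> {-R..R} \<or> snd z \<notin> {- max 2 t..max 2 t}"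
            by (cases z) (auto simp: R'_def)
          then show "\<Phi> z = 0" using supp[of "fst z"] B_supp[of "snd z"] by (auto simp: \<Phi>_def)
        qed
      qed
    qed
    also have "\<dots> = (LINT s|lborel. indicator {0<..} s * (B 1 s * h s + B 0 s * k s))"
      unfolding inner using inner_meas by (simp add: integral_completion)
    ultimately show "(LINT s|lborel. indicator {0<..} s *
         (cut 1 (-2) \<eta> (t - \<eta>) 1 s * h s + cut 1 (-2) \<eta> (t - \<eta>) 0 s * k s)) + (LINT x|lebesgue. u0 x * A 0 x) = 0"
      by (simp add: B_def)
  qed
  then show ?thesis by (simp add: h_def k_def)
qed

end

section \<open>One-sided Lipschitz functions and mollified primitives\<close>

text \<open>The null set in \<open>osl\<close> depends on the shift \<open>a\<close>. Fubini in
  \<open>(x, a)\<close> and the substitution \<open>y = x + a\<close> trade it for one exceptional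
  set of base points; a further exchange of quantifiers covers the points \<open>y\<close> to the
  left of \<open>z\<close>.\<close>

lemma AE_one_sided_Lipschitz:
  fixes w :: "real \<Rightarrow> real"
  assumes w[measurable]: "w \<in> borel_measurable borel"
    and osl: "\<And>a. a > 0 \<Longrightarrow> AE x in lborel. w (x + a) - w x \<le> \<kappa> * a"
  shows "AE z in lborel. AE y in lborel. (z < y \<longrightarrow> w y - w z \<le> \<kappa> * (y - z)) \<and> (y < z \<longrightarrow> w z - w y \<le> \<kappa> * (z - y))"
proof -
  define P where "P z y \<longleftrightarrow> (z < y \<longrightarrow> w y - w z \<le> \<kappa> * (y - z))" for z y
  have P_meas: "{p \<in> space (lborel \<Otimes>\<^sub>M lborel). P (fst p) (snd p)} \<in> sets (lborel \<Otimes>\<^sub>M lborel)"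
    unfolding P_def by measurable
  have "AE a in lborel. AE x in lborel. P x (x + a)"
  proof (rule AE_I2)
    fix a :: real
    show "AE x in lborel. P x (x + a)"
      using osl[of a] by (cases "a > 0") (auto simp: P_def)
  qed
  then have "AE x in lborel. AE a in lborel. P x (x + a)"
  proof (rule lborel_pair.AE_commute[THEN iffD1, rotated])
    show "{p \<in> space (lborel \<Otimes>\<^sub>M lborel). P (snd p) (snd p + fst p)} \<in> sets (lborel \<Otimes>\<^sub>M lborel)"
      unfolding P_def by measurable
  qed
  then have 1: "AE x in lborel. AE y in lborel. P x y"
  proof eventually_elim
    case (elim x)
    have "Measurable.pred borel (\<lambda>a. P x (x + a))" unfolding P_def by measurable
    from AE_borel_affine[OF _ this elim, of 1 "-x"] show ?case by simp
  qed
  then have 2: "AE y in lborel. AE x in lborel. P x y"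
    by (rule lborel_pair.AE_commute[OF P_meas, THEN iffD1])
  from 1 2 show ?thesis
  proof eventually_elim
    case (elim z)
    then show ?case by eventually_elim (simp add: P_def)
  qed
qed

locale bounded_slice =
  fixes w :: "real \<Rightarrow> real" and W :: real
  assumes w_meas [measurable]: "w \<in> borel_measurable borel" and w_bound: "\<And>x. \<bar>w x\<bar> \<le> W"
begin

lemma W_nonneg: "W \<ge> 0" using w_bound[of 0] by linarith

lemma integrable_mult_support:
  assumes "g \<in> borel_measurable borel" "\<And>x. \<bar>g x\<bar> \<le> K" "\<And>x. x \<notin> {a..b} \<Longrightarrow> g x = 0"
  shows "integrable lborel (\<lambda>y. w y * g y)"
proof (rule integrable_bounded_support[where K = "W * K" and a = a and b = b])
  show "\<bar>w x * g x\<bar> \<le> W * K" for x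
    unfolding abs_mult by (intro mult_mono w_bound assms) (use W_nonneg in auto)
qed (use assms in auto)

lemma set_integrable: "set_integrable lborel {a..b} w"
  unfolding set_integrable_def
  using integrable_mult_support[of "indicator {a..b}" 1 a b]
  by (auto simp: mult.commute indicator_def)

lemma set_integral_bound: "a \<le> b \<Longrightarrow> \<bar>LINT y:{a..b}|lborel. w y\<bar> \<le> W * (b - a)"
proof -
  assume "a \<le> b"
  have "\<bar>LINT y:{a..b}|lborel. w y\<bar> \<le> (LINT y|lborel. \<bar>indicator {a..b} y *\<^sub>R w y\<bar>)"
    unfolding set_lebesgue_integral_def by (rule integral_abs_bound)
  also have "\<dots> \<le> (LINT y|lborel. W * indicator {a..b} y)"
  proof (rule integral_mono)
    show "integrable lborel (\<lambda>y. \<bar>indicat_real {a..b} y *\<^sub>R w y\<bar>)"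
      using set_integrable[of a b] unfolding set_integrable_def by (rule integrable_abs)
    show "integrable lborel (\<lambda>y. W * indicat_real {a..b} y)"
      by (intro integrable_mult_right) (simp add: integrable_indicator_iff emeasure_lborel_Icc_eq)
  qed (use w_bound in \<open>auto simp: indicator_def\<close>)
  also have "\<dots> = W * (b - a)" using \<open>a \<le> b\<close> by simp
  finally show ?thesis .
qed

text \<open>For one good \<open>z\<close>, \<open>w\<close> is at most
  \<open>w z + \<kappa> * l\<close> to the right and at least \<open>w z - \<kappa> * l\<close> to
  the left. The exceptional set is the same for all \<open>l\<close>, so \<open>l\<close> may later
  be chosen depending on \<open>w z\<close>.\<close>

lemma osl_set_integral:
  assumes osl: "\<And>a. a > 0 \<Longrightarrow> AE x in lborel. w (x + a) - w x \<le> \<kappa> * a" and "\<kappa> \<ge> 0"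
  shows "AE z in lborel. \<forall>l\<ge>0. (LINT y:{z..z+l}|lborel. w y) \<le> (w z + \<kappa> * l) * l
    \<and> (LINT y:{z-l..z}|lborel. w y) \<ge> (w z - \<kappa> * l) * l"
proof -
  have "AE z in lborel. AE y in lborel. (z < y \<longrightarrow> w y - w z \<le> \<kappa> * (y - z)) \<and> (y < z \<longrightarrow> w z - w y \<le> \<kappa> * (z - y))"
    by (rule AE_one_sided_Lipschitz[OF w_meas]) (rule osl)
  then show ?thesis
  proof eventually_elim
    case (elim z)
    have const: "(LINT y:{a..b}|lborel. K) = K * (b - a)" "set_integrable lborel {a..b} (\<lambda>y. K)" if "a \<le> b" for a b K :: real
      using that by (auto simp: set_lebesgue_integral_def set_integrable_def integrable_indicator_iff
          emeasure_lborel_Icc_eq intro!: integrable_mult_left)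
    show ?case
    proof (intro allI impI conjI)
      fix l :: real assume l: "l \<ge> 0"
      have "(LINT y:{z..z+l}|lborel. w y) \<le> (LINT y:{z..z+l}|lborel. w z + \<kappa> * l)"
      proof (rule set_integral_mono_AE)
        show "AE y\<in>{z..z+l} in lborel. w y \<le> w z + \<kappa> * l"
          using elim
        proof (eventually_elim, intro impI)
          fix y assume y: "(z < y \<longrightarrow> w y - w z \<le> \<kappa> * (y - z)) \<and> (y < z \<longrightarrow> w z - w y \<le> \<kappa> * (z - y))" "y \<in> {z..z+l}"
          have "\<kappa> * (y - z) \<le> \<kappa> * l" using y \<open>\<kappa> \<ge> 0\<close> by (intro mult_left_mono) auto
          moreover have "0 \<le> \<kappa> * l" using l \<open>\<kappa> \<ge> 0\<close> by simp
          ultimately show "w y \<le> w z + \<kappa> * l" using y by (cases "y = z") auto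
        qed
      qed (use set_integrable const l in auto)
      then show "(LINT y:{z..z+l}|lborel. w y) \<le> (w z + \<kappa> * l) * l" using const[of z "z + l"] l by (simp add: algebra_simps)
      have "(LINT y:{z-l..z}|lborel. w z - \<kappa> * l) \<le> (LINT y:{z-l..z}|lborel. w y)"
      proof (rule set_integral_mono_AE)
        show "AE y\<in>{z-l..z} in lborel. w z - \<kappa> * l \<le> w y"
          using elim
        proof (eventually_elim, intro impI)
          fix y assume y: "(z < y \<longrightarrow> w y - w z \<le> \<kappa> * (y - z)) \<and> (y < z \<longrightarrow> w z - w y \<le> \<kappa> * (z - y))" "y \<in> {z-l..z}"
          have "\<kappa> * (z - y) \<le> \<kappa> * l" using y \<open>\<kappa> \<ge> 0\<close> by (intro mult_left_mono) auto
          moreover have "0 \<le> \<kappa> * l" using l \<open>\<kappa> \<ge> 0\<close> by simp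
          ultimately show "w z - \<kappa> * l \<le> w y" using y by (cases "y = z") auto
        qed
      qed (use set_integrable const l in auto)
      then show "(LINT y:{z-l..z}|lborel. w y) \<ge> (w z - \<kappa> * l) * l" using const[of "z - l" z] l by (simp add: algebra_simps)
    qed
  qed
qed

text \<open>A positive value forces a large integral to the left of \<open>z\<close>, a negative one
  a large negative integral to the right. The relevant length depends on \<open>z\<close>, hence the
  quantifiers inside.\<close>

lemma osl_pointwise_bound:
  assumes osl: "\<And>a. a > 0 \<Longrightarrow> AE x in lborel. w (x + a) - w x \<le> \<kappa> * a" and "\<kappa> > 0"
  shows "AE z in lborel. \<forall>Q. (\<forall>l\<ge>0. (LINT y:{z..z+l}|lborel. w y) \<ge> - Q \<and> (LINT y:{z-l..z}|lborel. w y) \<le> Q)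
    \<longrightarrow> (w z)\<^sup>2 \<le> 4 * \<kappa> * Q"
proof -
  have "AE z in lborel. \<forall>l\<ge>0. (LINT y:{z..z+l}|lborel. w y) \<le> (w z + \<kappa> * l) * l
    \<and> (LINT y:{z-l..z}|lborel. w y) \<ge> (w z - \<kappa> * l) * l"
    by (rule osl_set_integral) (use osl \<open>\<kappa> > 0\<close> in auto)
  then show ?thesis
  proof (eventually_elim, intro allI impI)
    fix z Q
    assume A: "\<forall>l\<ge>0. (LINT y:{z..z+l}|lborel. w y) \<le> (w z + \<kappa> * l) * l \<and> (LINT y:{z-l..z}|lborel. w y) \<ge> (w z - \<kappa> * l) * l"
      and Q: "\<forall>l\<ge>0. (LINT y:{z..z+l}|lborel. w y) \<ge> - Q \<and> (LINT y:{z-l..z}|lborel. w y) \<le> Q"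
    \<comment> \<open>This maximises \<open>(\<bar>w z\<bar> - \<kappa> * l) * l\<close>; the
      maximum, the square of \<open>w z\<close> divided by \<open>4 * \<kappa>\<close>, is the
      origin of the factor 4.\<close>
    define l where "l = \<bar>w z\<bar> / (2 * \<kappa>)"
    have l: "l \<ge> 0" "\<kappa> * l = \<bar>w z\<bar> / 2" using \<open>\<kappa> > 0\<close> by (auto simp: l_def)
    have "\<bar>w z\<bar> / 2 * l \<le> Q"
    proof (cases "w z \<ge> 0")
      case True
      have "(w z - \<kappa> * l) * l \<le> Q" using A Q l(1) by (meson order_trans)
      then show ?thesis using True l(2) by simp
    next
      case False
      have "- Q \<le> (w z + \<kappa> * l) * l" using A Q l(1) by (meson order_trans)
      then show ?thesis using False unfolding l(2) by (simp add: algebra_simps)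
    qed
    then have "4 * \<kappa> * (\<bar>w z\<bar> / 2 * l) \<le> 4 * \<kappa> * Q" using \<open>\<kappa> > 0\<close> by (intro mult_left_mono) auto
    moreover have "4 * \<kappa> * (\<bar>w z\<bar> / 2 * l) = (w z)\<^sup>2"
      using \<open>\<kappa> > 0\<close> by (simp add: l_def power2_eq_square)
    ultimately show "(w z)\<^sup>2 \<le> 4 * \<kappa> * Q" by linarith
  qed
qed

end

section \<open>Integrals with mollified endpoints\<close>

definition mollifier :: "real \<Rightarrow> real \<Rightarrow> real \<Rightarrow> real" where
  "mollifier \<delta> x y = - (1 / \<delta>) * sstep 1 ((y - x) / \<delta>)"

text \<open>Testing the conservation law with a cutoff therefore produces a difference of two
  mollified fluxes. The kernel is also the derivative of the cutoff of order 0 in its right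
  endpoint, hence the slope of a mollified primitive.\<close>

lemma cut_1: "cut \<delta> a \<delta> b 1 y = mollifier \<delta> a y - mollifier \<delta> b y"
  by (simp add: cut_def mollifier_def)

lemma mollifier_measurable [measurable]: "mollifier \<delta> x \<in> borel_measurable borel"
  unfolding mollifier_def[abs_def] by measurable

lemma mollifier_nonneg: "\<delta> > 0 \<Longrightarrow> mollifier \<delta> x y \<ge> 0"
  using sstep_1_nonpos[of "(y - x) / \<delta>"] by (simp add: mollifier_def divide_nonpos_pos)

lemma mollifier_out: "\<delta> > 0 \<Longrightarrow> y \<notin> {x..x+\<delta>} \<Longrightarrow> mollifier \<delta> x y = 0"
  using sstep_out[of "(y - x) / \<delta>" 0] by (force simp: mollifier_def divide_le_0_iff le_divide_eq)

lemma mollifier_bounded: "\<exists>B\<ge>0. \<forall>y. \<bar>mollifier \<delta> x y\<bar> \<le> B"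
proof -
  obtain B where "\<And>y. \<bar>sstep 1 y\<bar> \<le> B" using sstep_bounded[of 1] by auto
  then have B: "\<bar>mollifier \<delta> x y\<bar> \<le> \<bar>1 / \<delta>\<bar> * B" for y
    unfolding mollifier_def abs_mult by (intro mult_mono) auto
  show ?thesis using B order_trans[OF abs_ge_zero B] by blast
qed

lemma mollifier_integral: "\<delta> > 0 \<Longrightarrow> integrable lborel (mollifier \<delta> x)" "\<delta> > 0 \<Longrightarrow> (LINT y|lborel. mollifier \<delta> x y) = 1"
proof -
  assume \<delta>: "\<delta> > 0"
  obtain B where B: "\<And>y. \<bar>mollifier \<delta> x y\<bar> \<le> B" using mollifier_bounded by blast
  show "integrable lborel (mollifier \<delta> x)"
    by (rule integrable_bounded_support[OF _ B mollifier_out[OF \<delta>]]) auto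
  have "(LINT y|lborel. mollifier \<delta> x y * indicator {x..x+\<delta>} y) = - sstep 0 ((x + \<delta> - x) / \<delta>) - - sstep 0 ((x - x) / \<delta>)"
  proof (rule integral_FTC_Icc_real)
    fix y
    have i: "((\<lambda>s. (s - x) / \<delta>) has_real_derivative 1 / \<delta>) (at y)"
      by (rule DERIV_cong[OF DERIV_cdivide[OF DERIV_diff[OF DERIV_ident DERIV_const]]]) simp
    show "((\<lambda>s. - sstep 0 ((s - x) / \<delta>)) has_real_derivative mollifier \<delta> x y) (at y)"
      by (rule DERIV_cong[OF DERIV_minus[OF DERIV_chain2[OF sstep_DERIV i]]]) (simp add: mollifier_def)
    have "continuous_on UNIV (mollifier \<delta> x)"
      unfolding mollifier_def[abs_def] by (intro continuous_intros) (use \<delta> in auto)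
    then show "isCont (mollifier \<delta> x) y" by (simp add: continuous_on_eq_continuous_at)
  qed (use \<delta> in auto)
  moreover have "mollifier \<delta> x y * indicator {x..x+\<delta>} y = mollifier \<delta> x y" for y
    using mollifier_out[OF \<delta>, of y x] by (cases "y \<in> {x..x+\<delta>}") auto
  ultimately have "(LINT y|lborel. mollifier \<delta> x y) = - sstep 0 ((x + \<delta> - x) / \<delta>) - - sstep 0 ((x - x) / \<delta>)"
    by (simp only:)
  then show "(LINT y|lborel. mollifier \<delta> x y) = 1" using \<delta> by (simp add: sstep_left sstep_right)
qed

text \<open>\<open>B\<close> bounds the second derivative. The remainder is estimated by the mean
  value inequality, which gives away the factor 1/2.\<close>

lemma sstep_taylor: "\<exists>B\<ge>0. \<forall>s h. \<bar>sstep 0 (s - h) - sstep 0 s + h * sstep 1 s\<bar> \<le> B * h\<^sup>2"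
proof -
  obtain B where B: "B \<ge> 0" "\<And>x. \<bar>sstep 2 x\<bar> \<le> B" using sstep_bounded[of 2] by auto
  have lip: "\<bar>sstep 1 x - sstep 1 y\<bar> \<le> B * \<bar>x - y\<bar>" for x y
    using field_differentiable_bound[of UNIV "sstep 1" "sstep 2" B x y] sstep_DERIV[of 1] B
    by (simp add: numeral_2_eq_2)
  have "\<bar>sstep 0 (s - h) - sstep 0 s + h * sstep 1 s\<bar> \<le> B * h\<^sup>2" for s h :: real
  proof -
    define g where "g r = sstep 0 (s - r) + r * sstep 1 s" for r :: real
    have d: "(g has_real_derivative sstep 1 s - sstep 1 (s - r)) (at r within cball 0 \<bar>h\<bar>)" for r
    proof -
      have i: "((\<lambda>r. s - r) has_real_derivative -1) (at r)"
        by (rule DERIV_cong[OF DERIV_diff[OF DERIV_const DERIV_ident]]) simp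
      have "(g has_real_derivative sstep 1 s - sstep 1 (s - r)) (at r)"
        unfolding g_def[abs_def]
        by (rule DERIV_cong[OF DERIV_add[OF DERIV_chain2[OF sstep_DERIV i] DERIV_cmult_right[OF DERIV_ident]]]) simp
      then show ?thesis by (rule has_field_derivative_at_within)
    qed
    have "norm (g h - g 0) \<le> (B * \<bar>h\<bar>) * norm (h - 0)"
    proof (rule field_differentiable_bound[OF _ d])
      fix r :: real assume "r \<in> cball 0 \<bar>h\<bar>"
      then have "B * \<bar>r\<bar> \<le> B * \<bar>h\<bar>" using B(1) by (intro mult_left_mono) auto
      then show "norm (sstep 1 s - sstep 1 (s - r)) \<le> B * \<bar>h\<bar>" using lip[of s "s - r"] by simp
    qed auto
    then show ?thesis by (simp add: g_def power2_eq_square mult.assoc algebra_simps)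
  qed
  then show ?thesis using B(1) by blast
qed

context bounded_slice
begin

text \<open>The cutoff and the indicator differ by at most 1, and only on two layers of length
  \<delta> at the ends.\<close>

lemma cut_integral_approx:
  assumes \<delta>: "\<delta> > 0" and "a \<le> b"
  shows "\<bar>(LINT y|lborel. w y * cut \<delta> a \<delta> b 0 y) - (LINT y:{a..b}|lborel. w y)\<bar> \<le> 2 * W * \<delta>"
proof -
  obtain B where B: "\<And>y. \<bar>cut \<delta> a \<delta> b 0 y\<bar> \<le> B" using cut_bounded by blast
  have int1: "integrable lborel (\<lambda>y. w y * cut \<delta> a \<delta> b 0 y)"
    by (rule integrable_mult_support[OF _ B, where a = a and b = "b + \<delta>"])
      (use \<delta> \<open>a \<le> b\<close> in \<open>auto intro!: cut_out\<close>)
  have int2: "integrable lborel (\<lambda>y. w y * indicator {a..b} y)"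
    using set_integrable[of a b] by (simp add: set_integrable_def mult.commute)
  have pt: "\<bar>cut \<delta> a \<delta> b 0 y - indicator {a..b} y\<bar> \<le> indicator {a..a+\<delta>} y + indicator {b..b+\<delta>} y" for y
  proof -
    consider "y < a" | "a \<le> y" "y \<le> b" | "y > b" by linarith
    then show ?thesis
    proof cases
      case 1
      then show ?thesis using \<delta> \<open>a \<le> b\<close> by (simp add: cut_def sstep_left divide_le_0_iff)
    next
      case 2
      then have s: "sstep 0 ((y - b) / \<delta>) = 1" using \<delta> by (simp add: sstep_left divide_le_0_iff)
      show ?thesis
      proof (cases "y \<le> a + \<delta>")
        case True
        then show ?thesis using 2 s sstep_range[of "(y - a) / \<delta>"] by (simp add: cut_def indicator_def)
      next
        case False
        then have "sstep 0 ((y - a) / \<delta>) = 0" using \<delta> by (simp add: sstep_right le_divide_eq)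
        then show ?thesis using 2 s by (simp add: cut_def)
      qed
    next
      case 3
      have i: "indicator {a..b} y = (0::real)" using 3 by simp
      show ?thesis
      proof (cases "y \<le> b + \<delta>")
        case True
        have j: "indicator {b..b+\<delta>} y = (1::real)" using True 3 by simp
        have "\<bar>cut \<delta> a \<delta> b 0 y\<bar> \<le> 1"
          using sstep_range[of "(y - a) / \<delta>"] sstep_range[of "(y - b) / \<delta>"] by (auto simp: cut_def abs_le_iff)
        then show ?thesis unfolding i j by (simp add: indicator_def)
      next
        case False
        then have "cut \<delta> a \<delta> b 0 y = 0" using \<delta> \<open>a \<le> b\<close> by (intro cut_out) auto
        then show ?thesis unfolding i by simp
      qed
    qed
  qed
  have "(LINT y|lborel. w y * cut \<delta> a \<delta> b 0 y) - (LINT y:{a..b}|lborel. w y)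
      = (LINT y|lborel. w y * (cut \<delta> a \<delta> b 0 y - indicator {a..b} y))"
    using int1 int2 by (simp add: set_lebesgue_integral_def right_diff_distrib mult.commute)
  also have "\<bar>\<dots>\<bar> \<le> (LINT y|lborel. \<bar>w y * (cut \<delta> a \<delta> b 0 y - indicator {a..b} y)\<bar>)"
    by (rule integral_abs_bound)
  also have "\<dots> \<le> (LINT y|lborel. W * (indicator {a..a+\<delta>} y + indicator {b..b+\<delta>} y))"
  proof (rule integral_mono)
    show "integrable lborel (\<lambda>y. \<bar>w y * (cut \<delta> a \<delta> b 0 y - indicator {a..b} y)\<bar>)"
      using int1 int2 by (intro integrable_abs) (simp add: right_diff_distrib)
    show "integrable lborel (\<lambda>y. W * (indicator {a..a+\<delta>} y + indicator {b..b+\<delta>} y))"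
      by (intro integrable_mult_right Bochner_Integration.integrable_add)
        (auto simp: integrable_indicator_iff emeasure_lborel_Icc_eq)
    show "\<bar>w y * (cut \<delta> a \<delta> b 0 y - indicator {a..b} y)\<bar> \<le> W * (indicator {a..a+\<delta>} y + indicator {b..b+\<delta>} y)" for y
      unfolding abs_mult by (intro mult_mono w_bound pt) (use W_nonneg in auto)
  qed
  also have "\<dots> = 2 * W * \<delta>"
    using \<delta> by (subst Bochner_Integration.integral_mult_right_zero, subst Bochner_Integration.integral_add)
      (auto simp: integrable_indicator_iff emeasure_lborel_Icc_eq)
  finally show ?thesis .
qed

text \<open>The integral is the slope at \<open>x\<close> of the mollified primitive, and
  \<open>x\<close> is within \<open>e\<close> of its supremum. Moving by \<open>r\<close> in either
  direction can raise it by at most \<open>e\<close>, while the second-order error is at most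
  \<open>3 * W * B / \<delta>\<close> times the square of \<open>r\<close>.\<close>

lemma mollifier_integral_near_max:
  assumes \<delta>: "\<delta> > 0" and "0 < r" "r \<le> \<delta>"
    and B: "B \<ge> 0" "\<And>s h. \<bar>sstep 0 (s - h) - sstep 0 s + h * sstep 1 s\<bar> \<le> B * h\<^sup>2"
    and max: "\<And>z. (LINT y|lborel. w y * cut \<delta> x \<delta> z 0 y) \<le> e"
  shows "\<bar>LINT y|lborel. w y * mollifier \<delta> x y\<bar> \<le> e / r + 3 * W * B * r / \<delta>"
proof -
  define m where "m = (LINT y|lborel. w y * mollifier \<delta> x y)"
  obtain K where K: "\<And>y. \<bar>mollifier \<delta> x y\<bar> \<le> K" using mollifier_bounded by blast
  have int1: "integrable lborel (\<lambda>y. w y * mollifier \<delta> x y)"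
    by (rule integrable_mult_support[OF _ K mollifier_out[OF \<delta>]]) auto
  have *: "h * m \<le> e + 3 * W * B * h\<^sup>2 / \<delta>" if "\<bar>h\<bar> \<le> \<delta>" for h
  proof -
    obtain K' where K': "\<And>y. \<bar>cut \<delta> x \<delta> (x + h) 0 y\<bar> \<le> K'" using cut_bounded by blast
    have int2: "integrable lborel (\<lambda>y. w y * cut \<delta> x \<delta> (x + h) 0 y)"
      by (rule integrable_mult_support[OF _ K', where a = "x - \<delta>" and b = "x + 2 * \<delta>"])
        (use \<delta> that in \<open>auto intro!: cut_out\<close>)
    \<comment> \<open>A window of length \<open>3 * \<delta>\<close> contains both supports for
      every \<open>h\<close> of size at most \<delta>.\<close>
    have pt: "\<bar>h * mollifier \<delta> x y - cut \<delta> x \<delta> (x + h) 0 y\<bar> \<le> B * h\<^sup>2 / \<delta>\<^sup>2 * indicator {x-\<delta>..x+2*\<delta>} y" for y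
    proof (cases "y \<in> {x-\<delta>..x+2*\<delta>}")
      case True
      have "cut \<delta> x \<delta> (x + h) 0 y - h * mollifier \<delta> x y
          = sstep 0 ((y - x) / \<delta> - h / \<delta>) - sstep 0 ((y - x) / \<delta>) + h / \<delta> * sstep 1 ((y - x) / \<delta>)"
        by (simp add: cut_def mollifier_def diff_divide_distrib[symmetric] algebra_simps)
      then show ?thesis
        using B(2)[of "(y - x) / \<delta>" "h / \<delta>"] True by (simp add: power_divide abs_minus_commute)
    next
      case False
      have "cut \<delta> x \<delta> (x + h) 0 y = 0" by (rule cut_out) (use \<delta> that False in auto)
      moreover have "mollifier \<delta> x y = 0" by (rule mollifier_out) (use \<delta> False in auto)
      ultimately show ?thesis using False by simp
    qed
    have "h * m - (LINT y|lborel. w y * cut \<delta> x \<delta> (x + h) 0 y)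
        = (LINT y|lborel. w y * (h * mollifier \<delta> x y - cut \<delta> x \<delta> (x + h) 0 y))"
      using int1 int2 by (simp add: m_def right_diff_distrib mult.left_commute)
    also have "\<dots> \<le> (LINT y|lborel. W * (B * h\<^sup>2 / \<delta>\<^sup>2 * indicator {x-\<delta>..x+2*\<delta>} y))"
    proof (rule integral_mono)
      show "integrable lborel (\<lambda>y. w y * (h * mollifier \<delta> x y - cut \<delta> x \<delta> (x + h) 0 y))"
        using int1 int2 by (simp add: right_diff_distrib mult.left_commute)
      show "integrable lborel (\<lambda>y. W * (B * h\<^sup>2 / \<delta>\<^sup>2 * indicator {x-\<delta>..x+2*\<delta>} y))"
        by (intro integrable_mult_right) (auto simp: integrable_indicator_iff emeasure_lborel_Icc_eq)
      show "w y * (h * mollifier \<delta> x y - cut \<delta> x \<delta> (x + h) 0 y) \<le> W * (B * h\<^sup>2 / \<delta>\<^sup>2 * indicator {x-\<delta>..x+2*\<delta>} y)" for y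
        by (rule order_trans[OF abs_ge_self], unfold abs_mult, intro mult_mono w_bound pt) (use W_nonneg in auto)
    qed
    also have "\<dots> = W * (B * h\<^sup>2 / \<delta>\<^sup>2 * (3 * \<delta>))" using \<delta> by simp
    also have "\<dots> = 3 * W * B * h\<^sup>2 / \<delta>" using \<delta> by (simp add: power2_eq_square)
    finally show ?thesis using max[of "x + h"] by linarith
  qed
  have "r * \<bar>m\<bar> \<le> e + 3 * W * B * r\<^sup>2 / \<delta>"
    using *[of r] *[of "- r"] \<open>0 < r\<close> \<open>r \<le> \<delta>\<close> by (cases "m \<ge> 0") auto
  then have "\<bar>m\<bar> \<le> (e + 3 * W * B * r\<^sup>2 / \<delta>) / r"
    using \<open>0 < r\<close> by (simp add: le_divide_eq mult.commute)
  also have "\<dots> = e / r + 3 * W * B * r / \<delta>"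
    using \<open>0 < r\<close> by (simp add: add_divide_distrib power2_eq_square)
  finally show ?thesis by (simp add: m_def)
qed

end

text \<open>Discrete minimum principle: on a time step short compared with \<open>e / L\<close>, a point where the
  minimum is almost attained at the end of the step was a near-minimum during the whole step, so
  there the minimum decreases at rate at most \<open>\<eta>\<close>. No minimum needs to be attained.\<close>

lemma minimum_principle:
  fixes V :: "real \<Rightarrow> real \<Rightarrow> real"
  assumes "a < b" and lip: "\<And>x s t. s \<in> {a..b} \<Longrightarrow> t \<in> {a..b} \<Longrightarrow> \<bar>V x t - V x s\<bar> \<le> L * \<bar>t - s\<bar>"
    and "e > 0"
    and near_min: "\<And>x s t. a \<le> s \<Longrightarrow> s < t \<Longrightarrow> t \<le> b \<Longrightarrow>
      (\<And>\<tau> y. s \<le> \<tau> \<Longrightarrow> \<tau> \<le> t \<Longrightarrow> V x \<tau> \<le> V y \<tau> + e) \<Longrightarrow> V x t - V x s \<ge> - \<eta> * (t - s)"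
    and m: "\<And>y. V y a \<ge> m"
  shows "V x b \<ge> m - \<eta> * (b - a)"
proof -
  have "0 \<le> L * \<bar>b - a\<bar>"
    using lip[of a b 0] \<open>a < b\<close> abs_ge_zero[of "V 0 b - V 0 a"] by (auto intro: order_trans)
  then have L: "L \<ge> 0" using \<open>a < b\<close> by (simp add: zero_le_mult_iff)
  \<comment> \<open>With this many steps \<open>V\<close> oscillates by at most \<open>e / 4\<close>
    within a step. A point within \<open>e / 2\<close> of the infimum at the end of a step is then
    within \<open>e\<close> of it throughout the step.\<close>
  obtain n :: nat where n: "real n > 4 * L * (b - a) / e" using reals_Archimedean2 by blast
  have "0 \<le> 4 * L * (b - a) / e" using L \<open>a < b\<close> \<open>e > 0\<close> by simp
  with n have n0: "real n > 0" by linarith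
  define d where "d = (b - a) / real n"
  have d: "d > 0" "real n * d = b - a" using \<open>a < b\<close> n0 by (auto simp: d_def)
  have "4 * L * (b - a) < e * real n" using n \<open>e > 0\<close> by (simp add: divide_less_eq mult.commute)
  then have Ld: "4 * L * d \<le> e" using n0 by (simp add: d_def divide_le_eq mult.commute mult.left_commute)
  have "\<forall>y. V y (a + real i * d) \<ge> m - \<eta> * (real i * d)" if "i \<le> n" for i
    using that
  proof (induction i)
    case (Suc i)
    define s t where "s = a + real i * d" and "t = a + real (Suc i) * d"
    have st: "a \<le> s" "t = s + d" using d by (auto simp: s_def t_def algebra_simps)
    have "real (Suc i) * d \<le> real n * d" using Suc.prems d(1) by (intro mult_right_mono) auto
    then have tb: "t \<le> b" using d(2) by (simp add: t_def)
    have osc: "\<bar>V y \<tau> - V y t\<bar> \<le> L * d" if "s \<le> \<tau>" "\<tau> \<le> t" for y \<tau>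
    proof -
      have "\<bar>V y \<tau> - V y t\<bar> \<le> L * \<bar>\<tau> - t\<bar>" by (rule lip) (use that st tb in auto)
      also have "\<dots> \<le> L * d" using that st L by (intro mult_left_mono) auto
      finally show ?thesis .
    qed
    have below: "V y t \<ge> m - \<eta> * (real i * d) - L * d" for y
    proof -
      have "V y s \<ge> m - \<eta> * (real i * d)" using Suc by (simp add: s_def)
      moreover have "V y s - V y t \<le> L * d" using osc[of s y, THEN abs_le_D1] st d(1) by simp
      ultimately show ?thesis by linarith
    qed
    define \<mu> where "\<mu> = (INF y. V y t)"
    have bdd: "bdd_below (range (\<lambda>y. V y t))" using below by (intro bdd_belowI2) auto
    have "\<mu> \<ge> m - \<eta> * (real (Suc i) * d)"
    proof (rule ccontr)
      assume "\<not> ?thesis"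
      then have gap: "\<mu> < m - \<eta> * (real (Suc i) * d)" by simp
      then have "\<mu> < min (m - \<eta> * (real (Suc i) * d)) (\<mu> + e / 2)" using \<open>e > 0\<close> by simp
      \<comment> \<open>Such an \<open>x\<close> lies below the target and is a near-minimum. Its
        value decreased at rate at most \<eta> during the step, which contradicts the induction
        hypothesis at \<open>s\<close>.\<close>
      then obtain x where x: "V x t < min (m - \<eta> * (real (Suc i) * d)) (\<mu> + e / 2)"
        unfolding \<mu>_def by (subst (asm) cINF_less_iff[OF _ bdd]) auto
      have "V x t - V x s \<ge> - \<eta> * (t - s)"
      proof (rule near_min)
        fix \<tau> y assume \<tau>: "s \<le> \<tau>" "\<tau> \<le> t"
        have "\<mu> \<le> V y t" unfolding \<mu>_def by (rule cINF_lower[OF bdd]) simp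
        then show "V x \<tau> \<le> V y \<tau> + e"
          using osc[OF \<tau>, of x, THEN abs_le_D1] osc[OF \<tau>, of y, THEN abs_le_D2] x Ld
          by (simp add: min_less_iff_conj)
      qed (use st tb d in auto)
      moreover have "V x s \<ge> m - \<eta> * (real i * d)" using Suc by (simp add: s_def)
      moreover have "\<eta> * (real (Suc i) * d) = \<eta> * (real i * d) + \<eta> * d" by (simp add: algebra_simps)
      ultimately show False using x st by simp
    qed
    moreover have "\<mu> \<le> V y t" for y unfolding \<mu>_def by (rule cINF_lower[OF bdd]) simp
    ultimately show ?case unfolding t_def by (meson order_trans)
  qed (use m in simp)
  from this[of n] show ?thesis using d by simp
qed

section \<open>Evolution of the mollified primitive\<close>

lemma set_integral_Ioc_const:
  fixes K :: real
  assumes "a \<le> b"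
  shows "set_integrable lborel {a<..b} (\<lambda>s. K)" "(LINT s:{a<..b}|lborel. K) = K * (b - a)"
  using assms by (auto simp: set_lebesgue_integral_def set_integrable_def integrable_indicator_iff
      intro!: integrable_mult_left)

text \<open>The integral in \<open>min\<close> is the increment from \<open>x\<close> to \<open>z\<close> of a mollified primitive of \<open>w\<close>, so \<open>min\<close>
  says that this primitive is within \<open>e\<close> of its infimum at \<open>x\<close>. One-sided Lipschitz continuity of \<open>w\<close> is
  semiconcavity of the primitive, whose slope is therefore small near a minimum.\<close>

lemma (in bounded_slice) near_min_bound:
  assumes osl: "\<And>a. a > 0 \<Longrightarrow> AE x in lborel. w (x + a) - w x \<le> \<kappa> * a" and "\<kappa> > 0"
    and \<delta>: "\<delta> > 0"
    and min: "\<And>z. (LINT y|lborel. w y * cut \<delta> x \<delta> z 0 y) \<ge> - e"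
  shows "AE y in lborel. y \<in> {x..x+\<delta>} \<longrightarrow> (w y)\<^sup>2 \<le> 4 * \<kappa> * (e + 5 * W * \<delta>)"
proof -
  define J where "J a b = (LINT y|lborel. w y * cut \<delta> a \<delta> b 0 y)" for a b
  have J_approx: "\<bar>J a b - (LINT y:{a..b}|lborel. w y)\<bar> \<le> 2 * W * \<delta>" if "a \<le> b" for a b
    unfolding J_def by (rule cut_integral_approx[OF \<delta> that])
  have J_int: "integrable lborel (\<lambda>y. w y * cut \<delta> a \<delta> b 0 y)" for a b
  proof -
    obtain B where B: "\<And>y. \<bar>cut \<delta> a \<delta> b 0 y\<bar> \<le> B" using cut_bounded by blast
    show ?thesis
      by (rule integrable_mult_support[OF _ B, where a = "min a b" and b = "max a b + \<delta>"])
        (use \<delta> in \<open>auto intro!: cut_out\<close>)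
  qed
  \<comment> \<open>Exact, since a cutoff is a difference of two steps; comparison with sharp
    integrals is what costs multiples of \<open>W * \<delta>\<close>.\<close>
  have J_diff: "J a b = J x b - J x a" for a b
    using J_int by (simp add: J_def cut_def right_diff_distrib flip: Bochner_Integration.integral_diff)
  have "AE z in lborel. \<forall>Q. (\<forall>l\<ge>0. (LINT y:{z..z+l}|lborel. w y) \<ge> - Q \<and> (LINT y:{z-l..z}|lborel. w y) \<le> Q)
    \<longrightarrow> (w z)\<^sup>2 \<le> 4 * \<kappa> * Q"
    by (rule osl_pointwise_bound) (use osl \<open>\<kappa> > 0\<close> in auto)
  then show ?thesis
  proof (eventually_elim, intro impI)
    fix z
    assume Q: "\<forall>Q. (\<forall>l\<ge>0. (LINT y:{z..z+l}|lborel. w y) \<ge> - Q \<and> (LINT y:{z-l..z}|lborel. w y) \<le> Q)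
      \<longrightarrow> (w z)\<^sup>2 \<le> 4 * \<kappa> * Q" and z: "z \<in> {x..x+\<delta>}"
    \<comment> \<open>Moving the base point from \<open>x\<close> to \<open>z\<close> costs
      \<open>3 * W * \<delta>\<close>, and sharpening the endpoints \<open>2 * W * \<delta>\<close>;
      together these are the \<open>5 * W * \<delta>\<close> of the statement.\<close>
    have "\<bar>LINT y:{x..z}|lborel. w y\<bar> \<le> W * (z - x)" using z by (intro set_integral_bound) auto
    also have "\<dots> \<le> W * \<delta>" using z W_nonneg by (intro mult_left_mono) auto
    finally have xz: "\<bar>J x z\<bar> \<le> 3 * W * \<delta>" using J_approx[of x z] z by auto
    have "(LINT y:{z..z+l}|lborel. w y) \<ge> - (e + 5 * W * \<delta>) \<and> (LINT y:{z-l..z}|lborel. w y) \<le> e + 5 * W * \<delta>"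
      if "l \<ge> 0" for l
      using J_approx[of z "z + l"] J_approx[of "z - l" z] J_diff[of z "z + l"] J_diff[of "z - l" z]
        min[of "z + l"] min[of "z - l"] xz that unfolding J_def[symmetric] by auto
    then show "(w z)\<^sup>2 \<le> 4 * \<kappa> * (e + 5 * W * \<delta>)" using Q by blast
  qed
qed

text \<open>\<open>g0\<close> represents the initial datum and \<open>K0\<close> bounds all
  integrals of its perturbation. Convexity of \<open>f\<close> enters through
  \<open>tangent\<close>, where \<open>f1\<close> will be the derivative of \<open>f\<close> at
  \<open>c\<close>.\<close>

locale entropy_slices = slices +
  fixes g0 :: "real \<Rightarrow> real" and c f1 E K0 :: real
  assumes g0_meas [measurable]: "g0 \<in> borel_measurable borel" and g0_bound: "\<And>x. \<bar>g0 x\<bar> \<le> M"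
    and u0_eq: "AE x in lebesgue. u0 x = g0 x" and u0_meas: "u0 \<in> borel_measurable lebesgue"
    and c_bound: "\<bar>c\<bar> \<le> M"
    and tangent: "\<And>p. f p - f c \<ge> f1 * (p - c)"
    and E_pos: "E > 0"
    and oleinik: "\<And>t a. t > 0 \<Longrightarrow> a > 0 \<Longrightarrow> AE x in lborel. v t (x + a) - v t x \<le> E / t * a"
    and K0: "\<And>a b. a \<le> b \<Longrightarrow> \<bar>LINT y:{a..b}|lborel. g0 y - c\<bar> \<le> K0"
begin

sublocale w: bounded_slice "\<lambda>x. v t x - c" "2 * M" for t
proof
  show "\<bar>v t x - c\<bar> \<le> 2 * M" for x using v_bound[of t x] c_bound by linarith
qed simp

sublocale w0: bounded_slice "\<lambda>x. g0 x - c" "2 * M"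
proof
  show "\<bar>g0 x - c\<bar> \<le> 2 * M" for x using g0_bound[of x] c_bound by linarith
qed simp

lemma K0_nonneg: "K0 \<ge> 0" using K0[of 0 0] abs_ge_zero by (meson order_refl order_trans)

context
  fixes \<delta> :: real
  assumes \<delta>: "\<delta> > 0"
begin

text \<open>\<open>F x t\<close> is the mollified flux relative to \<open>f c\<close>, and \<open>J t a b\<close> is the integral of
  \<open>v t - c\<close> over \<open>[a, b]\<close> with mollified endpoints.\<close>

definition F :: "real \<Rightarrow> real \<Rightarrow> real" where
  "F x t = (LINT y|lborel. (f (v t y) - f c) * mollifier \<delta> x y)"

definition J :: "real \<Rightarrow> real \<Rightarrow> real \<Rightarrow> real" where
  "J t a b = (LINT y|lborel. (v t y - c) * cut \<delta> a \<delta> b 0 y)"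

lemma flux_bound: "\<bar>f (v t y) - f c\<bar> \<le> 2 * L * M"
proof -
  have "\<bar>f (v t y) - f c\<bar> \<le> L * \<bar>v t y - c\<bar>" using v_bound c_bound by (rule lip)
  also have "\<dots> \<le> L * (2 * M)" using L_nonneg w.w_bound by (intro mult_left_mono) auto
  finally show ?thesis by simp
qed

lemma F_integrable: "integrable lborel (\<lambda>y. (f (v t y) - f c) * mollifier \<delta> x y)"
proof -
  interpret bounded_slice "\<lambda>y. f (v t y) - f c" "2 * L * M" by standard (use flux_bound in auto)
  obtain B where B: "\<And>y. \<bar>mollifier \<delta> x y\<bar> \<le> B" using mollifier_bounded by blast
  show ?thesis by (rule integrable_mult_support[OF _ B mollifier_out[OF \<delta>]]) auto
qed

lemma F_le:
  assumes "AE y in lborel. y \<in> {x..x+\<delta>} \<longrightarrow> \<bar>f (v t y) - f c\<bar> \<le> \<eta>"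
  shows "\<bar>F x t\<bar> \<le> \<eta>"
proof -
  have "\<bar>F x t\<bar> \<le> (LINT y|lborel. \<bar>(f (v t y) - f c) * mollifier \<delta> x y\<bar>)"
    unfolding F_def by (rule integral_abs_bound)
  also have "\<dots> \<le> (LINT y|lborel. \<eta> * mollifier \<delta> x y)"
  proof (rule integral_mono_AE)
    show "AE y in lborel. \<bar>(f (v t y) - f c) * mollifier \<delta> x y\<bar> \<le> \<eta> * mollifier \<delta> x y"
      using assms
    proof eventually_elim
      case (elim y)
      then show ?case
        using mollifier_nonneg[OF \<delta>, of x y] mollifier_out[OF \<delta>, of y x]
        by (cases "y \<in> {x..x+\<delta>}") (auto simp: abs_mult intro: mult_right_mono)
    qed
  qed (use F_integrable mollifier_integral[OF \<delta>] in \<open>auto intro: integrable_abs\<close>)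
  also have "\<dots> = \<eta>" using mollifier_integral[OF \<delta>] by simp
  finally show ?thesis .
qed

lemma F_bound: "\<bar>F x t\<bar> \<le> 2 * L * M"
  by (rule F_le) (use flux_bound in auto)

lemma F_cont: "t > 0 \<Longrightarrow> isCont (F x) t"
proof -
  assume t: "t > 0"
  obtain B where B: "\<And>y. \<bar>mollifier \<delta> x y\<bar> \<le> B" using mollifier_bounded by blast
  show ?thesis
    unfolding F_def[abs_def]
  proof (rule isCont_slice_integral[OF v_meas v_bound v_time_cont[OF t] _ _ L_nonneg mollifier_measurable B])
    show "\<bar>f p - f c - (f q - f c)\<bar> \<le> L * \<bar>p - q\<bar>" if "\<bar>p\<bar> \<le> M" "\<bar>q\<bar> \<le> M" for p q
      using lip[OF that] by simp
    show "mollifier \<delta> x y = 0" if "y \<notin> {- (\<bar>x\<bar> + \<delta> + 1)..\<bar>x\<bar> + \<delta> + 1}" for y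
      by (rule mollifier_out[OF \<delta>]) (use that \<delta> in auto)
  qed (use \<delta> in auto)
qed

lemma F_set_integrable: "0 \<le> a \<Longrightarrow> set_integrable lborel {a<..b} (F x)"
  by (rule set_integrable_Ioc[OF F_cont F_bound])

lemma F_set_integral_combine:
  assumes "0 \<le> a" "a \<le> b" "b \<le> d"
  shows "(LINT s:{a<..d}|lborel. F x s) = (LINT s:{a<..b}|lborel. F x s) + (LINT s:{b<..d}|lborel. F x s)"
proof -
  have "{a<..d} = {a<..b} \<union> {b<..d}" using assms by auto
  then show ?thesis
    using assms by (simp add: set_integral_Un[OF _ F_set_integrable F_set_integrable] disjoint_iff)
qed

lemma F_set_integral_lower:
  assumes "0 \<le> a" "a \<le> b" "\<And>s. a < s \<Longrightarrow> s \<le> b \<Longrightarrow> F x s \<ge> \<eta>"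
  shows "(LINT s:{a<..b}|lborel. F x s) \<ge> \<eta> * (b - a)"
  using set_integral_mono[OF set_integral_Ioc_const(1)[OF assms(2)] F_set_integrable[OF assms(1)], of \<eta>] assms
  by (simp add: set_integral_Ioc_const)

lemma F_set_integral_upper:
  assumes "0 \<le> a" "a \<le> b" "\<And>s. a < s \<Longrightarrow> s \<le> b \<Longrightarrow> F x s \<le> \<eta>"
  shows "(LINT s:{a<..b}|lborel. F x s) \<le> \<eta> * (b - a)"
  using set_integral_mono[OF F_set_integrable[OF assms(1)] set_integral_Ioc_const(1)[OF assms(2)], of x \<eta>] assms
  by (simp add: set_integral_Ioc_const)

lemma F_set_integral_bound:
  assumes "0 \<le> a" "a \<le> b"
  shows "\<bar>LINT s:{a<..b}|lborel. F x s\<bar> \<le> 2 * L * M * (b - a)"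
proof -
  have "- (2 * L * M) \<le> F x s \<and> F x s \<le> 2 * L * M" for s using F_bound[of x s] by linarith
  then show ?thesis
    using F_set_integral_lower[OF assms, of "- (2 * L * M)" x] F_set_integral_upper[OF assms, of x "2 * L * M"]
    by (simp add: abs_le_iff)
qed

lemma cut_integrable: "integrable lborel (cut \<delta> a \<delta> b 0)"
proof -
  obtain B where B: "\<And>y. \<bar>cut \<delta> a \<delta> b 0 y\<bar> \<le> B" using cut_bounded by blast
  show ?thesis
    by (rule integrable_bounded_support[OF _ B, where a = "min a b" and b = "max a b + \<delta>"])
      (use \<delta> in \<open>auto intro!: cut_out\<close>)
qed

lemma cut_mult_integrable:
  assumes "bounded_slice w W"
  shows "integrable lborel (\<lambda>y. w y * cut \<delta> a \<delta> b 0 y)"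
proof -
  obtain B where B: "\<And>y. \<bar>cut \<delta> a \<delta> b 0 y\<bar> \<le> B" using cut_bounded by blast
  show ?thesis
    by (rule bounded_slice.integrable_mult_support[OF assms _ B, where a = "min a b" and b = "max a b + \<delta>"])
      (use \<delta> in \<open>auto intro!: cut_out\<close>)
qed

lemma J_diff: "J t a b = J t x b - J t x a"
  using cut_mult_integrable[OF w.bounded_slice_axioms]
  by (simp add: J_def cut_def right_diff_distrib flip: Bochner_Integration.integral_diff)

text \<open>The mass between \<open>a\<close> and \<open>b\<close> grows by the flux in at
  \<open>a\<close> minus the flux out at \<open>b\<close>. Subtracting \<open>c\<close> changes both
  sides equally, and \<open>f c\<close> cancels because both mollifiers have mass one.\<close>

lemma J_evolution:
  assumes "t > 0"
  shows "J t a b = (LINT y|lborel. (g0 y - c) * cut \<delta> a \<delta> b 0 y)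
    + ((LINT s:{0<..t}|lborel. F a s) - (LINT s:{0<..t}|lborel. F b s))"
proof -
  obtain B1 B2 where B1: "\<And>y. \<bar>cut \<delta> a \<delta> b 0 y\<bar> \<le> B1" and B2: "\<And>y. \<bar>cut \<delta> a \<delta> b 1 y\<bar> \<le> B2"
    using cut_bounded by meson
  define R where "R = \<bar>a\<bar> + \<bar>b\<bar> + \<delta>"
  have "(LINT x|lborel. v t x * cut \<delta> a \<delta> b 0 x) = (LINT x|lebesgue. u0 x * cut \<delta> a \<delta> b 0 x)
      + (LINT s:{0<..t}|lborel. LINT x|lborel. f (v s x) * cut \<delta> a \<delta> b 1 x)"
  proof (rule conservation_law[OF smooth_seq_cut, where K = "max B1 B2" and R = R])
    show "x \<notin> {-R..R} \<Longrightarrow> cut \<delta> a \<delta> b 0 x = 0" "x \<notin> {-R..R} \<Longrightarrow> cut \<delta> a \<delta> b 1 x = 0" for x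
      by (rule cut_out; use \<delta> in \<open>force simp: R_def\<close>)+
  qed (use B1 B2 \<delta> assms in \<open>auto simp: R_def le_max_iff_disj\<close>)
  moreover have "(LINT x|lebesgue. u0 x * cut \<delta> a \<delta> b 0 x) = (LINT x|lborel. g0 x * cut \<delta> a \<delta> b 0 x)"
  proof -
    have [measurable]: "u0 \<in> borel_measurable lebesgue" "g0 \<in> borel_measurable lebesgue"
      "cut \<delta> a \<delta> b 0 \<in> borel_measurable lebesgue"
      using u0_meas by (auto intro: measurable_completion)
    have "(LINT x|lebesgue. u0 x * cut \<delta> a \<delta> b 0 x) = (LINT x|lebesgue. g0 x * cut \<delta> a \<delta> b 0 x)"
      using u0_eq by (intro integral_cong_AE) (measurable, auto elim: eventually_mono)
    then show ?thesis by (simp add: integral_completion)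
  qed
  moreover have "(LINT x|lborel. (v t x - c) * cut \<delta> a \<delta> b 0 x)
      = (LINT x|lborel. v t x * cut \<delta> a \<delta> b 0 x) - c * (LINT x|lborel. cut \<delta> a \<delta> b 0 x)"
    "(LINT x|lborel. (g0 x - c) * cut \<delta> a \<delta> b 0 x)
      = (LINT x|lborel. g0 x * cut \<delta> a \<delta> b 0 x) - c * (LINT x|lborel. cut \<delta> a \<delta> b 0 x)"
    using cut_mult_integrable[of "v t" M] cut_mult_integrable[of g0 M] cut_integrable v_bound g0_bound
    by (auto simp: left_diff_distrib bounded_slice_def)
  moreover have "(LINT x|lborel. f (v s x) * cut \<delta> a \<delta> b 1 x) = F a s - F b s" for s
  proof -
    have int: "integrable lborel (\<lambda>y. f (v s y) * mollifier \<delta> x y)" for x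
      using Bochner_Integration.integrable_add[OF F_integrable[of s x] integrable_mult_right[OF mollifier_integral(1)[OF \<delta>, of x], of "f c"]]
      by (simp add: algebra_simps)
    have "F x s = (LINT y|lborel. f (v s y) * mollifier \<delta> x y) - f c" for x
      using int mollifier_integral[OF \<delta>] by (simp add: F_def left_diff_distrib)
    then show ?thesis using int by (simp add: cut_1[unfolded One_nat_def] right_diff_distrib)
  qed
  moreover have "(LINT s:{0<..t}|lborel. F a s - F b s) = (LINT s:{0<..t}|lborel. F a s) - (LINT s:{0<..t}|lborel. F b s)"
    by (intro set_integral_diff F_set_integrable) auto
  ultimately show ?thesis by (simp add: J_def)
qed

end

end

section \<open>Fluxes at near-extrema and the bound on the primitive\<close>

context entropy_slices
begin

text \<open>From time \<open>a0\<close> on, \<open>E / a0\<close> is a common one-sided Lipschitz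
  constant, so one scale serves all later times. Then \<open>v \<tau>\<close> is within
  \<open>s\<close> of \<open>c\<close> on the support of the mollifier, and \<open>f\<close> is
  Lipschitz.\<close>

lemma F_small_near_min:
  assumes \<delta>: "\<delta> > 0" and "a0 > 0" "\<tau> \<ge> a0" and "s \<ge> 0"
    and small: "4 * (E / a0) * (e + 10 * M * \<delta>) \<le> s\<^sup>2"
    and min: "\<And>z. J \<delta> \<tau> x z \<ge> - e"
  shows "\<bar>F \<delta> x \<tau>\<bar> \<le> L * s"
proof (rule F_le[OF \<delta>])
  have osl: "AE y in lborel. (v \<tau> (y + a) - c) - (v \<tau> y - c) \<le> E / a0 * a" if "a > 0" for a
  proof -
    have "E / \<tau> * a \<le> E / a0 * a"
      using assms(2,3) E_pos that by (intro mult_right_mono divide_left_mono) auto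
    then show ?thesis
      using oleinik[of \<tau> a] assms(2,3) that by (auto elim!: eventually_mono)
  qed
  have "AE y in lborel. y \<in> {x..x+\<delta>} \<longrightarrow> (v \<tau> y - c)\<^sup>2 \<le> 4 * (E / a0) * (e + 5 * (2 * M) * \<delta>)"
    by (rule w.near_min_bound[OF osl _ \<delta>]) (use E_pos \<open>a0 > 0\<close> min in \<open>auto simp: J_def[OF \<delta>]\<close>)
  then show "AE y in lborel. y \<in> {x..x+\<delta>} \<longrightarrow> \<bar>f (v \<tau> y) - f c\<bar> \<le> L * s"
  proof (eventually_elim, intro impI)
    fix y assume "y \<in> {x..x+\<delta>} \<longrightarrow> (v \<tau> y - c)\<^sup>2 \<le> 4 * (E / a0) * (e + 5 * (2 * M) * \<delta>)" "y \<in> {x..x+\<delta>}"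
    then have "\<bar>v \<tau> y - c\<bar>\<^sup>2 \<le> s\<^sup>2" using small by simp
    then have "\<bar>v \<tau> y - c\<bar> \<le> s" using \<open>s \<ge> 0\<close> by (rule power2_le_imp_le)
    then have "L * \<bar>v \<tau> y - c\<bar> \<le> L * s" using L_nonneg by (rule mult_left_mono)
    then show "\<bar>f (v \<tau> y) - f c\<bar> \<le> L * s" using lip[OF v_bound c_bound, of \<tau> y] by linarith
  qed
qed

text \<open>Semiconcavity gives nothing at a maximum. There the tangent line bound replaces \<open>f\<close> by a linear
  flux, and the mollified slope is small because the mollified primitive is smooth, with constants
  depending on \<open>\<delta>\<close>.\<close>

lemma F_lower_near_max:
  assumes \<delta>: "\<delta> > 0" and "0 < r" "r \<le> \<delta>"
    and B: "B \<ge> 0" "\<And>s h. \<bar>sstep 0 (s - h) - sstep 0 s + h * sstep 1 s\<bar> \<le> B * h\<^sup>2"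
    and max: "\<And>z. J \<delta> \<tau> x z \<le> e"
  shows "F \<delta> x \<tau> \<ge> - (\<bar>f1\<bar> * (e / r + 6 * M * B * r / \<delta>))"
proof -
  define m where "m = (LINT y|lborel. (v \<tau> y - c) * mollifier \<delta> x y)"
  obtain K where K: "\<And>y. \<bar>mollifier \<delta> x y\<bar> \<le> K" using mollifier_bounded by blast
  have int: "integrable lborel (\<lambda>y. (v \<tau> y - c) * mollifier \<delta> x y)"
    by (rule w.integrable_mult_support[OF _ K mollifier_out[OF \<delta>]]) auto
  have "\<bar>m\<bar> \<le> e / r + 3 * (2 * M) * B * r / \<delta>"
    unfolding m_def
    by (rule w.mollifier_integral_near_max[OF \<delta> assms(2,3) B]) (use max in \<open>auto simp: J_def[OF \<delta>]\<close>)
  then have "\<bar>f1\<bar> * \<bar>m\<bar> \<le> \<bar>f1\<bar> * (e / r + 6 * M * B * r / \<delta>)"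
    by (intro mult_left_mono) auto
  moreover have "f1 * m \<ge> - (\<bar>f1\<bar> * \<bar>m\<bar>)" by (metis abs_ge_minus_self abs_mult minus_le_iff)
  moreover have "f1 * m \<le> F \<delta> x \<tau>"
  proof -
    have "f1 * m = (LINT y|lborel. f1 * ((v \<tau> y - c) * mollifier \<delta> x y))"
      by (simp add: m_def)
    also have "\<dots> \<le> F \<delta> x \<tau>"
      unfolding F_def[OF \<delta>]
    proof (rule integral_mono)
      show "f1 * ((v \<tau> y - c) * mollifier \<delta> x y) \<le> (f (v \<tau> y) - f c) * mollifier \<delta> x y" for y
        using mult_right_mono[OF tangent mollifier_nonneg[OF \<delta>], of "v \<tau> y" x y] by (simp add: mult.assoc)
    qed (use int F_integrable[OF \<delta>] in auto)
    finally show ?thesis .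
  qed
  ultimately show ?thesis by linarith
qed

text \<open>In the bound on the primitive, \<open>K0\<close> comes from the data,
  \<open>4 * M\<close> from mollifying the initial integrals, and the two units from the initial
  layer and the drift. The factor 2 passes from values to increments.\<close>

lemma primitive_bound:
  assumes T: "T > 0"
  obtains \<delta> where "\<delta> > 0" "\<delta> \<le> 1" "\<And>x z. \<bar>J \<delta> T x z\<bar> \<le> 2 * (K0 + 4 * M + 2)"
proof -
  define K where "K = 2 * L * M"
  have K_nonneg: "K \<ge> 0" using L_nonneg M_nonneg by (simp add: K_def)
  \<comment> \<open>With \<open>K\<close> as crude flux bound, the two flux integrals over the
    initial layer contribute at most \<open>2 * K * a0\<close>, hence at most 1.\<close>
  define a0 where "a0 = min (T / 2) (1 / (2 * K + 1))"
  have a0: "0 < a0" "a0 < T" using T K_nonneg by (auto simp: a0_def)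
  have "2 * K * a0 \<le> 2 * K * (1 / (2 * K + 1))" using K_nonneg by (intro mult_left_mono) (auto simp: a0_def)
  also have "\<dots> \<le> 1" using K_nonneg by (simp add: field_simps)
  finally have Ka0: "2 * K * a0 \<le> 1" .
  define \<eta> where "\<eta> = 1 / T"
  have \<eta>: "\<eta> > 0" "\<eta> * (T - a0) \<le> 1" using T a0 by (auto simp: \<eta>_def field_simps)
  define s where "s = \<eta> / (L + 1)"
  have s: "s > 0" "L * s \<le> \<eta>" using \<eta> L_nonneg by (auto simp: s_def field_simps)
  define \<kappa> where "\<kappa> = E / a0"
  have \<kappa>: "\<kappa> > 0" using E_pos a0 by (simp add: \<kappa>_def)
  \<comment> \<open>\<delta> is both the mollification scale and the tolerance in the minimum
    principle. In \<open>1 + 10 * M\<close> the 1 stands for the tolerance and \<open>10 * M\<close>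
    for the mollification error.\<close>
  define \<delta> where "\<delta> = min 1 (s\<^sup>2 / (4 * \<kappa> * (1 + 10 * M)))"
  have \<delta>: "\<delta> > 0" "\<delta> \<le> 1" using s \<kappa> M_nonneg by (auto simp: \<delta>_def)
  have "4 * \<kappa> * (1 + 10 * M) > 0" using \<kappa> M_nonneg by auto
  moreover have "\<delta> \<le> s\<^sup>2 / (4 * \<kappa> * (1 + 10 * M))" by (simp add: \<delta>_def)
  ultimately have "\<delta> * (4 * \<kappa> * (1 + 10 * M)) \<le> s\<^sup>2" by (simp add: le_divide_eq)
  then have small: "4 * (E / a0) * (\<delta> + 10 * M * \<delta>) \<le> s\<^sup>2" by (simp add: \<kappa>_def algebra_simps)
  obtain B where B: "B \<ge> 0" "\<And>s h. \<bar>sstep 0 (s - h) - sstep 0 s + h * sstep 1 s\<bar> \<le> B * h\<^sup>2"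
    using sstep_taylor by blast
  \<comment> \<open>At a near-maximum the flux error is \<open>\<bar>f1\<bar> * (e / r)\<close> plus
    \<open>q * r\<close>. With \<delta> already fixed, \<open>r\<close> is chosen to make the second
    term at most \<open>\<eta> / 2\<close>, then \<open>e\<close> to do the same for the
    first.\<close>
  define q where "q = \<bar>f1\<bar> * (6 * M * B / \<delta>)"
  have q: "q \<ge> 0" using M_nonneg B(1) \<delta> by (simp add: q_def)
  define r where "r = min \<delta> (\<eta> / (2 * (q + 1)))"
  have r: "0 < r" "r \<le> \<delta>" using \<delta> \<eta> q by (auto simp: r_def)
  have "q * r \<le> q * (\<eta> / (2 * (q + 1)))" using q by (intro mult_left_mono) (auto simp: r_def)
  also have "\<dots> \<le> \<eta> / 2" using q \<eta> by (simp add: field_simps)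
  finally have qr: "q * r \<le> \<eta> / 2" .
  define e where "e = \<eta> * r / (2 * (\<bar>f1\<bar> + 1))"
  have e: "e > 0" using \<eta> r by (simp add: e_def add_nonneg_pos)
  have "\<bar>f1\<bar> * (e / r) = \<eta> / 2 * (\<bar>f1\<bar> / (\<bar>f1\<bar> + 1))" using r by (simp add: e_def)
  also have "\<dots> \<le> \<eta> / 2 * 1" using \<eta> by (intro mult_left_mono) auto
  finally have "\<bar>f1\<bar> * (e / r) \<le> \<eta> / 2" by simp
  moreover have "\<bar>f1\<bar> * (e / r + 6 * M * B * r / \<delta>) = \<bar>f1\<bar> * (e / r) + q * r"
    by (simp add: q_def distrib_left)
  ultimately have max_small: "\<bar>f1\<bar> * (e / r + 6 * M * B * r / \<delta>) \<le> \<eta>"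
    using qr by linarith

  \<comment> \<open>A primitive of the mollified \<open>v t - c\<close> whose additive constant makes \<open>V\<^sub>t = - F\<close>.\<close>
  define V where "V x t = J \<delta> a0 0 x - (LINT s:{a0<..t}|lborel. F \<delta> x s)" for x t
  have V_diff_time: "V x t = V x t' - (LINT s:{t'<..t}|lborel. F \<delta> x s)" if "a0 \<le> t'" "t' \<le> t" for x t t'
    using F_set_integral_combine[OF \<delta>(1), of a0 t' t x] that a0 by (simp add: V_def)
  \<comment> \<open>Hence near-extremality of \<open>V\<close> in space is exactly the hypothesis on
    \<open>J\<close> in the two flux estimates.\<close>
  have V_diff_space: "J \<delta> t x z = V z t - V x t" if "a0 \<le> t" for x z t
  proof -
    have "J \<delta> t x z = J \<delta> a0 x z + ((LINT s:{a0<..t}|lborel. F \<delta> x s) - (LINT s:{a0<..t}|lborel. F \<delta> z s))"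
      using J_evolution[OF \<delta>(1), of t x z] J_evolution[OF \<delta>(1), of a0 x z] that a0
        F_set_integral_combine[OF \<delta>(1), of 0 a0 t x] F_set_integral_combine[OF \<delta>(1), of 0 a0 t z] by simp
    also have "J \<delta> a0 x z = J \<delta> a0 0 z - J \<delta> a0 0 x" by (rule J_diff[OF \<delta>(1)])
    finally show ?thesis by (simp add: V_def)
  qed
  have V_lip: "\<bar>V x t - V x t'\<bar> \<le> K * \<bar>t - t'\<bar>" if "t' \<in> {a0..T}" "t \<in> {a0..T}" for x t t'
  proof -
    have *: "\<bar>V x t - V x t'\<bar> \<le> K * (t - t')" if "a0 \<le> t'" "t' \<le> t" for t t'
      using V_diff_time[OF that, of x] F_set_integral_bound[OF \<delta>(1), of t' t x] that a0 by (simp add: K_def)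
    show ?thesis
    proof (cases "t' \<le> t")
      case True
      then show ?thesis using *[of t' t] that by simp
    next
      case False
      then show ?thesis using *[of t t'] that by (simp add: abs_minus_commute)
    qed
  qed
  have start: "\<bar>V x a0\<bar> \<le> K0 + 4 * M + 1" for x
  proof -
    define J0 where "J0 a b = (LINT y|lborel. (g0 y - c) * cut \<delta> a \<delta> b 0 y)" for a b
    have J0_bound: "\<bar>J0 a b\<bar> \<le> K0 + 4 * M" if "a \<le> b" for a b
    proof -
      have "4 * M * \<delta> \<le> 4 * M * 1" using \<delta> M_nonneg by (intro mult_left_mono) auto
      then show ?thesis
        using w0.cut_integral_approx[OF \<delta>(1) that] K0[OF that] unfolding J0_def by linarith
    qed
    have "J0 x 0 = - J0 0 x"
    proof -
      have "cut \<delta> x \<delta> 0 0 y = - cut \<delta> 0 \<delta> x 0 y" for y by (simp add: cut_def)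
      then show ?thesis by (simp add: J0_def)
    qed
    then have "\<bar>J0 0 x\<bar> \<le> K0 + 4 * M" using J0_bound[of 0 x] J0_bound[of x 0] by (cases "0 \<le> x") auto
    moreover have "V x a0 = J0 0 x + ((LINT s:{0<..a0}|lborel. F \<delta> 0 s) - (LINT s:{0<..a0}|lborel. F \<delta> x s))"
      using J_evolution[OF \<delta>(1) a0(1), of 0 x] by (simp add: V_def J0_def set_lebesgue_integral_def)
    moreover have FI: "\<bar>LINT s:{0<..a0}|lborel. F \<delta> y s\<bar> \<le> K * a0" for y
      using F_set_integral_bound[OF \<delta>(1), of 0 a0 y] a0 by (simp add: K_def)
    ultimately show ?thesis using FI[of 0] FI[of x] Ka0 by linarith
  qed
  have lower: "V x T \<ge> - (K0 + 4 * M + 1) - \<eta> * (T - a0)" for x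
  proof (rule minimum_principle[where V = V, OF a0(2) V_lip \<delta>(1)])
    fix x t' t assume t: "a0 \<le> t'" "t' < t" "t \<le> T"
      and near: "\<And>\<tau> y. t' \<le> \<tau> \<Longrightarrow> \<tau> \<le> t \<Longrightarrow> V x \<tau> \<le> V y \<tau> + \<delta>"
    have "F \<delta> x \<tau> \<le> \<eta>" if "t' < \<tau>" "\<tau> \<le> t" for \<tau>
    proof -
      have "\<bar>F \<delta> x \<tau>\<bar> \<le> L * s"
      proof (rule F_small_near_min[OF \<delta>(1) a0(1) _ _ small])
        show "- \<delta> \<le> J \<delta> \<tau> x z" for z
          using near[of \<tau> z] V_diff_space[of \<tau> x z] t that by simp
      qed (use s t that in auto)
      then show ?thesis using s by linarith
    qed
    then have "(LINT s:{t'<..t}|lborel. F \<delta> x s) \<le> \<eta> * (t - t')"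
      using t a0 by (intro F_set_integral_upper[OF \<delta>(1)]) auto
    then show "- \<eta> * (t - t') \<le> V x t - V x t'" using V_diff_time[of t' t x] t by simp
  next
    show "- (K0 + 4 * M + 1) \<le> V y a0" for y using start[of y] by linarith
  qed
  have upper: "- V x T \<ge> - (K0 + 4 * M + 1) - \<eta> * (T - a0)" for x
  proof (rule minimum_principle[where V = "\<lambda>x t. - V x t", OF a0(2) _ e])
    show "\<bar>- V x t - - V x t'\<bar> \<le> K * \<bar>t - t'\<bar>" if "t' \<in> {a0..T}" "t \<in> {a0..T}" for x t t'
      using V_lip[OF that, of x] by (simp add: abs_minus_commute)
  next
    fix x t' t assume t: "a0 \<le> t'" "t' < t" "t \<le> T"
      and near: "\<And>\<tau> y. t' \<le> \<tau> \<Longrightarrow> \<tau> \<le> t \<Longrightarrow> - V x \<tau> \<le> - V y \<tau> + e"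
    have "F \<delta> x \<tau> \<ge> - \<eta>" if "t' < \<tau>" "\<tau> \<le> t" for \<tau>
    proof -
      have "F \<delta> x \<tau> \<ge> - (\<bar>f1\<bar> * (e / r + 6 * M * B * r / \<delta>))"
      proof (rule F_lower_near_max[OF \<delta>(1) r B])
        show "J \<delta> \<tau> x z \<le> e" for z
          using near[of \<tau> z] V_diff_space[of \<tau> x z] t that by simp
      qed
      then show ?thesis using max_small by linarith
    qed
    then have "(LINT s:{t'<..t}|lborel. F \<delta> x s) \<ge> - \<eta> * (t - t')"
      using t a0 by (intro F_set_integral_lower[OF \<delta>(1)]) auto
    then show "- \<eta> * (t - t') \<le> - V x t - - V x t'" using V_diff_time[of t' t x] t by simp
  next
    show "- (K0 + 4 * M + 1) \<le> - V y a0" for y using start[of y] by linarith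
  qed
  have "\<bar>J \<delta> T x z\<bar> \<le> 2 * (K0 + 4 * M + 2)" for x z
    using V_diff_space[of T x z] a0(2) lower[of x] lower[of z] upper[of x] upper[of z] \<eta>(2)
    by (simp add: abs_le_iff)
  with \<delta> that show ?thesis by blast
qed

text \<open>Returning to sharp endpoints costs another \<open>4 * M\<close>, as \<delta> is at most
  1. The pointwise bound then applies with one-sided Lipschitz constant
  \<open>E / T\<close>.\<close>

lemma decay:
  assumes T: "T > 0"
  shows "AE x in lborel. \<bar>v T x - c\<bar> \<le> sqrt (4 * E * (2 * (K0 + 4 * M + 2) + 4 * M)) / sqrt T"
proof -
  obtain \<delta> where \<delta>: "\<delta> > 0" "\<delta> \<le> 1" and J: "\<And>x z. \<bar>J \<delta> T x z\<bar> \<le> 2 * (K0 + 4 * M + 2)"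
    using primitive_bound[OF T] by blast
  define Q where "Q = 2 * (K0 + 4 * M + 2) + 4 * M"
  have bound: "\<bar>LINT y:{a..b}|lborel. v T y - c\<bar> \<le> Q" if "a \<le> b" for a b
  proof -
    have "4 * M * \<delta> \<le> 4 * M * 1" using \<delta> M_nonneg by (intro mult_left_mono) auto
    then show ?thesis
      using w.cut_integral_approx[OF \<delta>(1) that, of T] J[of a b] unfolding J_def[OF \<delta>(1)] Q_def by linarith
  qed
  have "AE z in lborel. \<forall>Q. (\<forall>l\<ge>0. (LINT y:{z..z+l}|lborel. v T y - c) \<ge> - Q
      \<and> (LINT y:{z-l..z}|lborel. v T y - c) \<le> Q) \<longrightarrow> (v T z - c)\<^sup>2 \<le> 4 * (E / T) * Q"
    by (rule w.osl_pointwise_bound) (use oleinik[OF T] E_pos T in auto)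
  then show ?thesis
  proof eventually_elim
    case (elim z)
    have "(LINT y:{z..z+l}|lborel. v T y - c) \<ge> - Q \<and> (LINT y:{z-l..z}|lborel. v T y - c) \<le> Q" if "l \<ge> 0" for l
      using bound[of z "z + l"] bound[of "z - l" z] that by (simp add: abs_le_iff)
    then have "(v T z - c)\<^sup>2 \<le> 4 * E * Q / T" using elim by (simp add: mult.assoc)
    then have "sqrt ((v T z - c)\<^sup>2) \<le> sqrt (4 * E * Q / T)" by (rule real_sqrt_le_mono)
    then show ?case by (simp add: real_sqrt_divide Q_def)
  qed
qed

end

section \<open>Periodic perturbations\<close>

lemma AE_lborel_shift:
  fixes P :: "real \<Rightarrow> bool"
  assumes "AE x in lborel. P x"
  shows "AE x in lborel. P (x + a)"
proof -
  obtain N where N: "{x. \<not> P x} \<subseteq> N" "emeasure lborel N = 0" "N \<in> sets lborel"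
    using AE_E[OF assms] by auto
  have "AE x in lborel. x \<notin> N" using N by (intro AE_not_in) (auto simp: null_sets_def)
  moreover have "Measurable.pred borel (\<lambda>x. x \<notin> N)" using N(3) by simp
  ultimately have "AE x in lborel. a + 1 * x \<notin> N" by (intro AE_borel_affine) auto
  then show ?thesis
    by eventually_elim (use N(1) in \<open>auto simp: add.commute\<close>)
qed

lemma (in bounded_slice) set_integral_combine:
  assumes "a \<le> b" "b \<le> d"
  shows "(LINT y:{a..d}|lborel. w y) = (LINT y:{a..b}|lborel. w y) + (LINT y:{b..d}|lborel. w y)"
proof -
  have "AE x in lborel. \<not> (x \<in> {a..b} \<and> x \<in> {b..d})"
    using AE_lborel_singleton[of b] by eventually_elim auto
  then show ?thesis
    using set_integral_Un_AE[OF _ _ _ set_integrable[of a b] set_integrable[of b d]] ivl_disj_un_two_touch(4)[OF assms]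
    by simp
qed

text \<open>Every window of length \<open>p\<close> has integral 0, so whole periods drop out and a
  remainder of length at most \<open>p\<close> is left.\<close>

lemma (in bounded_slice) set_integral_periodic_bound:
  assumes "p > 0" and periodic: "AE x in lborel. w (x + p) = w x" and mean: "(LINT y:{0..p}|lborel. w y) = 0"
    and "a \<le> b"
  shows "\<bar>LINT y:{a..b}|lborel. w y\<bar> \<le> W * p"
proof -
  have shift: "(LINT y:{x+p..z+p}|lborel. w y) = (LINT y:{x..z}|lborel. w y)" for x z
  proof -
    have "(LINT y:{x+p..z+p}|lborel. w y) = (LINT y|lborel. indicator {x+p..z+p} (p + 1 * y) *\<^sub>R w (p + 1 * y))"
      unfolding set_lebesgue_integral_def by (subst lborel_integral_real_affine[of 1 _ p]) auto
    also have "\<dots> = (LINT y:{x..z}|lborel. w y)"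
      unfolding set_lebesgue_integral_def
    proof (rule integral_cong_AE)
      show "AE y in lborel. indicat_real {x+p..z+p} (p + 1 * y) *\<^sub>R w (p + 1 * y) = indicat_real {x..z} y *\<^sub>R w y"
        using periodic by eventually_elim (auto simp: indicator_def add.commute)
    qed auto
    finally show ?thesis .
  qed
  \<comment> \<open>The interval from \<open>x\<close> to \<open>z + p\<close> is split once at
    \<open>z\<close> and once at \<open>x + p\<close>.\<close>
  have window_eq: "(LINT y:{z..z+p}|lborel. w y) = (LINT y:{x..x+p}|lborel. w y)" if "x \<le> z" for x z
  proof -
    have "(LINT y:{x..z}|lborel. w y) + (LINT y:{z..z+p}|lborel. w y)
        = (LINT y:{x..x+p}|lborel. w y) + (LINT y:{x+p..z+p}|lborel. w y)"
      using set_integral_combine[of x z "z + p"] set_integral_combine[of x "x + p" "z + p"] that \<open>p > 0\<close> by simp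
    then show ?thesis using shift[of x z] by simp
  qed
  have window: "(LINT y:{x..x+p}|lborel. w y) = 0" for x
    using window_eq[of 0 x] window_eq[of x 0] mean by (cases "0 \<le> x") auto
  have windows: "(LINT y:{a..a + real n * p}|lborel. w y) = 0" for n
  proof (induction n)
    case 0
    show ?case using set_integral_bound[of a a] by simp
  next
    case (Suc n)
    have "(LINT y:{a..a + real n * p + p}|lborel. w y) = (LINT y:{a..a + real n * p}|lborel. w y)
        + (LINT y:{a + real n * p..a + real n * p + p}|lborel. w y)"
      using \<open>p > 0\<close> by (intro set_integral_combine) auto
    then show ?case using Suc window[of "a + real n * p"] by (simp add: algebra_simps)
  qed
  define n where "n = nat \<lfloor>(b - a) / p\<rfloor>"
  have "0 \<le> (b - a) / p" using \<open>a \<le> b\<close> \<open>p > 0\<close> by simp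
  then have n: "real n \<le> (b - a) / p" "(b - a) / p \<le> real n + 1" unfolding n_def by linarith+
  then have n': "a + real n * p \<le> b" "b - (a + real n * p) \<le> p"
    using \<open>p > 0\<close> by (auto simp: le_divide_eq divide_le_eq algebra_simps)
  have "(LINT y:{a..b}|lborel. w y) = (LINT y:{a + real n * p..b}|lborel. w y)"
    using set_integral_combine[of a "a + real n * p" b] windows[of n] n'(1) \<open>p > 0\<close> by simp
  also have "\<bar>\<dots>\<bar> \<le> W * (b - (a + real n * p))" by (rule set_integral_bound[OF n'(1)])
  also have "\<dots> \<le> W * p" using n'(2) W_nonneg by (rule mult_left_mono)
  finally show ?thesis .
qed

text \<open>Periodicity almost everywhere passes to the representative because translates of null
  sets are null.\<close>

lemma periodic_mean_zero_representative:
  assumes w: "Linf lebesgue w" and p: "p > 0" "periodic_ae p w"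
    and mean: "1 / p * (LINT x:{0..p}|lebesgue. w x) = 0"
  obtains h W where "bounded_slice h W" "AE x in lborel. w x = h x"
    "\<And>a b. a \<le> b \<Longrightarrow> \<bar>LINT y:{a..b}|lborel. h y\<bar> \<le> W * p"
proof -
  have wm[measurable]: "w \<in> borel_measurable lebesgue" using w by (simp add: Linf_def)
  obtain W where W: "W \<ge> 0" "AE x in lebesgue. \<bar>w x\<bar> \<le> W" using Linf_bound[OF w] .
  obtain h where h: "h \<in> borel_measurable borel" "\<And>x. \<bar>h x\<bar> \<le> W" "AE x in lebesgue. w x = h x"
    using bounded_borel_representative[OF wm W(2,1)] by blast
  interpret bounded_slice h W by standard (use h in auto)
  have eq: "AE x in lborel. w x = h x" using h(3) by (simp add: AE_completion_iff)
  have "AE x in lborel. w (x + p) = w x" using p(2) by (simp add: periodic_ae_def AE_completion_iff)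
  with eq AE_lborel_shift[OF eq, of p] have periodic: "AE x in lborel. h (x + p) = h x"
    by eventually_elim simp
  have "(LINT x:{0..p}|lebesgue. w x) = (LINT x:{0..p}|lebesgue. h x)"
    unfolding set_lebesgue_integral_def
  proof (rule integral_cong_AE)
    have [measurable]: "h \<in> borel_measurable lebesgue" using h(1) by (auto intro: measurable_completion)
    have [measurable]: "indicat_real {0..p} \<in> borel_measurable lebesgue" by (intro borel_measurable_indicator) auto
    show "(\<lambda>x. indicat_real {0..p} x *\<^sub>R w x) \<in> borel_measurable lebesgue"
      "(\<lambda>x. indicat_real {0..p} x *\<^sub>R h x) \<in> borel_measurable lebesgue" by measurable
    show "AE x in lebesgue. indicat_real {0..p} x *\<^sub>R w x = indicat_real {0..p} x *\<^sub>R h x"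
      using h(3) by eventually_elim simp
  qed
  also have "\<dots> = (LINT x:{0..p}|lborel. h x)"
    unfolding set_lebesgue_integral_def using h(1) by (intro integral_completion) simp
  finally have "(LINT x:{0..p}|lborel. h x) = 0" using mean p(1) by simp
  from that[OF bounded_slice_axioms eq set_integral_periodic_bound[OF p(1) periodic this]]
  show ?thesis .
qed

lemma glued_primitive_bound:
  fixes g hl hr :: "real \<Rightarrow> real"
  assumes g: "bounded_slice g W" and "bounded_slice hl Wl" "bounded_slice hr Wr" and "N > 0"
    and left: "AE x in lborel. x < - N \<longrightarrow> g x = hl x" and right: "AE x in lborel. x > N \<longrightarrow> g x = hr x"
    and bl: "\<And>a b. a \<le> b \<Longrightarrow> \<bar>LINT y:{a..b}|lborel. hl y\<bar> \<le> Kl"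
    and br: "\<And>a b. a \<le> b \<Longrightarrow> \<bar>LINT y:{a..b}|lborel. hr y\<bar> \<le> Kr"
    and ab: "a \<le> b"
  shows "\<bar>LINT y:{a..b}|lborel. g y\<bar> \<le> Kl + W * (2 * N) + Kr"
proof -
  interpret g: bounded_slice g W by fact
  interpret hl: bounded_slice hl Wl by fact
  interpret hr: bounded_slice hr Wr by fact
  have pos: "0 \<le> Kl" "0 \<le> Kr" using bl[of 0 0] br[of 0 0] abs_ge_zero by (meson order_refl order_trans)+
  have l: "\<bar>LINT y:{x..z}|lborel. g y\<bar> \<le> Kl" if "x \<le> z" "x = z \<or> z \<le> - N" for x z
  proof (cases "x = z")
    case True
    then show ?thesis using g.set_integral_bound[of x x] pos by simp
  next
    case False
    have "(LINT y:{x..z}|lborel. g y) = (LINT y:{x..z}|lborel. hl y)"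
      unfolding set_lebesgue_integral_def
    proof (rule integral_cong_AE)
      show "AE y in lborel. indicat_real {x..z} y *\<^sub>R g y = indicat_real {x..z} y *\<^sub>R hl y"
        using left AE_lborel_singleton[of "- N"] by eventually_elim (use that False in \<open>auto simp: indicator_def\<close>)
    qed auto
    then show ?thesis using bl[OF that(1)] by simp
  qed
  have r: "\<bar>LINT y:{x..z}|lborel. g y\<bar> \<le> Kr" if "x \<le> z" "x = z \<or> N \<le> x" for x z
  proof (cases "x = z")
    case True
    then show ?thesis using g.set_integral_bound[of x x] pos by simp
  next
    case False
    have "(LINT y:{x..z}|lborel. g y) = (LINT y:{x..z}|lborel. hr y)"
      unfolding set_lebesgue_integral_def
    proof (rule integral_cong_AE)
      show "AE y in lborel. indicat_real {x..z} y *\<^sub>R g y = indicat_real {x..z} y *\<^sub>R hr y"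
        using right AE_lborel_singleton[of N] by eventually_elim (use that False in \<open>auto simp: indicator_def\<close>)
    qed auto
    then show ?thesis using br[OF that(1)] by simp
  qed
  \<comment> \<open>\<open>p\<close> and \<open>q\<close> are \<open>- N\<close> and
    \<open>N\<close> clamped to \<open>[a, b]\<close>. The outer pieces may degenerate to points,
    hence the alternative \<open>x = z\<close> in the two estimates above.\<close>
  define p where "p = max a (min b (- N))"
  define q where "q = max p (min b N)"
  have pq: "a \<le> p" "p \<le> q" "q \<le> b" "a = p \<or> p \<le> - N" "q = b \<or> N \<le> q" "q - p \<le> 2 * N"
    using ab \<open>N > 0\<close> by (auto simp: p_def q_def max_def min_def)
  have "(LINT y:{a..b}|lborel. g y) = (LINT y:{a..p}|lborel. g y) + (LINT y:{p..q}|lborel. g y) + (LINT y:{q..b}|lborel. g y)"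
    using g.set_integral_combine[of a p b] g.set_integral_combine[of p q b] pq by simp
  moreover have "\<bar>LINT y:{p..q}|lborel. g y\<bar> \<le> W * (2 * N)"
    by (rule order_trans[OF g.set_integral_bound[OF pq(2)]]) (use pq g.W_nonneg in \<open>auto intro: mult_left_mono\<close>)
  moreover have "\<bar>LINT y:{a..p}|lborel. g y\<bar> \<le> Kl" using l pq by blast
  moreover have "\<bar>LINT y:{q..b}|lborel. g y\<bar> \<le> Kr" using r pq by blast
  ultimately show ?thesis by linarith
qed

theorem theorem2p3:
  fixes f f' f'' :: "real \<Rightarrow> real"
    and ul ur pl pr N :: real
    and wl wr u0 :: "real \<Rightarrow> real"
    and u :: "real \<Rightarrow> real \<Rightarrow> real"
  assumes f': "\<And>v. (f has_real_derivative f' v) (at v)"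
    and f'': "\<And>v. (f' has_real_derivative f'' v) (at v)"
    and f''_cont: "continuous_on UNIV f''"
    and f''_pos: "\<And>v. f'' v > 0"
    and ul_eq_ur: "ul = ur"
    and pl: "pl > 0" and pr: "pr > 0"
    and wl: "Linf lebesgue wl" and wr: "Linf lebesgue wr"
    and wl_periodic: "periodic_ae pl wl" and wr_periodic: "periodic_ae pr wr"
    and wl_mean: "1 / pl * (LINT x:{0..pl}|lebesgue. wl x) = 0"
    and wr_mean: "1 / pr * (LINT x:{0..pr}|lebesgue. wr x) = 0"
    and N: "N > 0"
    and u0: "Linf lebesgue u0"
    and u0_left: "AE x in lebesgue. x < - N \<longrightarrow> u0 x = ul + wl x"
    and u0_right: "AE x in lebesgue. x > N \<longrightarrow> u0 x = ur + wr x"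
    and u: "entropy_solution f u0 u"
  shows "\<exists>C>0. \<forall>t>0. esssup lebesgue (\<lambda>x. ereal \<bar>u x t - ul\<bar>) \<le> ereal (C / sqrt t)"
proof -
  let ?\<Omega> = "UNIV \<times> {0<..} :: (real \<times> real) set"
  have Linf_u: "Linf (lebesgue_on ?\<Omega>) (\<lambda>(x, t). u x t)"
    and slice: "\<And>t. t > 0 \<Longrightarrow> Linf lebesgue (\<lambda>x. u x t)"
    and tc: "time_continuous u" and weak: "weak_solution f u0 u" and ol: "oleinik_condition u"
    using u by (auto simp: entropy_solution_def)
  have slice_meas: "(\<lambda>x. u x t) \<in> borel_measurable lebesgue" if "t > 0" for t
    using slice[OF that] by (simp add: Linf_def)
  have u0_meas: "u0 \<in> borel_measurable lebesgue" using u0 by (simp add: Linf_def)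
  obtain B1 where B1: "B1 \<ge> 0" "AE z in lebesgue_on ?\<Omega>. \<bar>(\<lambda>(x, t). u x t) z\<bar> \<le> B1"
    using Linf_bound[OF Linf_u] .
  obtain B2 where B2: "B2 \<ge> 0" "AE x in lebesgue. \<bar>u0 x\<bar> \<le> B2" using Linf_bound[OF u0] .
  \<comment> \<open>One constant that bounds the solution, the datum and the reference
    state.\<close>
  define M where "M = B1 + B2 + \<bar>ul\<bar>"
  have M: "M \<ge> 0" "\<bar>ul\<bar> \<le> M" using B1(1) B2(1) by (auto simp: M_def)
  have u_bound: "AE z in lebesgue_on ?\<Omega>. \<bar>(\<lambda>(x, t). u x t) z\<bar> \<le> M"
    using B1(2) by eventually_elim (use B2(1) in \<open>auto simp: M_def\<close>)
  have u0_bound: "AE x in lebesgue. \<bar>u0 x\<bar> \<le> M"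
    using B2(2) by eventually_elim (use B1(1) in \<open>auto simp: M_def\<close>)
  have slice_bd: "AE x in lebesgue. \<bar>u x t\<bar> \<le> M" if "t > 0" for t
  proof (rule slice_bound[OF slice tc _ that])
    have \<Omega>: "?\<Omega> \<in> sets lebesgue" by (intro sets_completionI_sets) (simp add: borel_open open_Times)
    have "AE z in lebesgue. z \<in> ?\<Omega> \<longrightarrow> \<bar>u (fst z) (snd z)\<bar> \<le> M"
      using u_bound \<Omega> by (subst (asm) AE_restrict_space_iff) (auto simp: case_prod_beta')
    then have "AE z in lborel. snd z > 0 \<longrightarrow> \<bar>u (fst z) (snd z)\<bar> \<le> M"
      unfolding AE_completion_iff by eventually_elim (auto simp: mem_Times_iff)
    from AE_lborel_prod_snd[OF this]
    show "AE t in lborel. 0 < t \<longrightarrow> (AE x in lebesgue. \<bar>u x t\<bar> \<le> M)"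
      by eventually_elim (simp add: AE_completion_iff)
  qed auto
  \<comment> \<open>At nonpositive times the zero function is taken, so measurability and the bound
    hold for every \<open>t\<close>.\<close>
  have "\<exists>h. h \<in> borel_measurable borel \<and> (\<forall>x. \<bar>h x\<bar> \<le> M) \<and> (t > 0 \<longrightarrow> (AE x in lebesgue. u x t = h x))" for t
  proof (cases "t > 0")
    case True
    then show ?thesis
      using bounded_borel_representative[OF slice_meas[OF True] slice_bd[OF True] M(1)] by metis
  next
    case False
    then show ?thesis using M(1) by (intro exI[of _ "\<lambda>_. 0"]) auto
  qed
  then obtain v where v: "\<And>t. v t \<in> borel_measurable borel" "\<And>t x. \<bar>v t x\<bar> \<le> M"
    "\<And>t. t > 0 \<Longrightarrow> AE x in lebesgue. u x t = v t x" by metis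
  obtain g0 where g0: "g0 \<in> borel_measurable borel" "\<And>x. \<bar>g0 x\<bar> \<le> M" "AE x in lebesgue. u0 x = g0 x"
    using bounded_borel_representative[OF u0_meas u0_bound M(1)] by blast
  have f_meas: "f \<in> borel_measurable borel"
    using f' by (intro borel_measurable_continuous_onI continuous_at_imp_continuous_on) (auto intro: DERIV_isCont)
  obtain L where L: "L \<ge> 0" "\<And>p. p \<in> {-M..M} \<Longrightarrow> \<bar>f' p\<bar> \<le> L"
  proof -
    have "bounded (f' ` {-M..M})"
      using f'' by (intro compact_imp_bounded compact_continuous_image continuous_at_imp_continuous_on)
        (auto intro: DERIV_isCont)
    then obtain L where "\<forall>p\<in>{-M..M}. \<bar>f' p\<bar> \<le> L" unfolding bounded_iff by auto
    then show ?thesis using that[of "max 0 L"] by (auto simp: le_max_iff_disj)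
  qed
  have lip: "\<bar>f p - f q\<bar> \<le> L * \<bar>p - q\<bar>" if "\<bar>p\<bar> \<le> M" "\<bar>q\<bar> \<le> M" for p q
  proof -
    have "norm (f p - f q) \<le> L * norm (p - q)"
    proof (rule field_differentiable_bound[of "{-M..M}" f f'])
      show "norm (f' z) \<le> L" if "z \<in> {-M..M}" for z using L(2)[OF that] by simp
    qed (use f' that in \<open>auto intro: has_field_derivative_at_within\<close>)
    then show ?thesis by simp
  qed
  have "convex_on UNIV f"
    using f' f'' f''_pos by (intro f''_ge0_imp_convex[of UNIV f f' f'']) (auto intro: less_imp_le)
  then have tangent: "f' ul * (p - ul) \<le> f p - f ul" for p
    using f' by (intro convex_on_imp_above_tangent[of UNIV]) auto
  obtain E where E: "E > 0" "\<And>t a. t > 0 \<Longrightarrow> a > 0 \<Longrightarrow> AE x in lebesgue. u (x + a) t - u x t \<le> E * a / t"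
    using ol by (auto simp: oleinik_condition_def)
  have oleinik: "AE x in lborel. v t (x + a) - v t x \<le> E / t * a" if "t > 0" "a > 0" for t a
  proof -
    have eq: "AE x in lborel. u x t = v t x" using v(3)[OF that(1)] by (simp add: AE_completion_iff)
    have "AE x in lborel. u (x + a) t - u x t \<le> E * a / t"
      using E(2)[OF that] by (simp add: AE_completion_iff)
    with eq AE_lborel_shift[OF eq, of a] show ?thesis by eventually_elim simp
  qed
  obtain hl Wl where hl: "bounded_slice hl Wl" "AE x in lborel. wl x = hl x"
    "\<And>a b. a \<le> b \<Longrightarrow> \<bar>LINT y:{a..b}|lborel. hl y\<bar> \<le> Wl * pl"
    using periodic_mean_zero_representative[OF wl pl wl_periodic wl_mean] by blast
  obtain hr Wr where hr: "bounded_slice hr Wr" "AE x in lborel. wr x = hr x"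
    "\<And>a b. a \<le> b \<Longrightarrow> \<bar>LINT y:{a..b}|lborel. hr y\<bar> \<le> Wr * pr"
    using periodic_mean_zero_representative[OF wr pr wr_periodic wr_mean] by blast
  \<comment> \<open>Each periodic side contributes at most one period, and the stretch between
    \<open>- N\<close> and \<open>N\<close> is bounded crudely.\<close>
  define K0 where "K0 = Wl * pl + 2 * M * (2 * N) + Wr * pr"
  have K0: "\<bar>LINT y:{a..b}|lborel. g0 y - ul\<bar> \<le> K0" if "a \<le> b" for a b
    unfolding K0_def
  proof (rule glued_primitive_bound[OF _ hl(1) hr(1) N _ _ hl(3) hr(3) that])
    show "bounded_slice (\<lambda>y. g0 y - ul) (2 * M)"
    proof
      show "\<bar>g0 x - ul\<bar> \<le> 2 * M" for x using g0(2)[of x] M(2) by linarith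
    qed (use g0(1) in simp)
    have eq: "AE x in lborel. u0 x = g0 x" using g0(3) by (simp add: AE_completion_iff)
    show "AE x in lborel. x < - N \<longrightarrow> g0 x - ul = hl x"
      using eq hl(2) u0_left[unfolded AE_completion_iff] by eventually_elim auto
    show "AE x in lborel. N < x \<longrightarrow> g0 x - ul = hr x"
      using eq hr(2) u0_right[unfolded AE_completion_iff] by eventually_elim (use ul_eq_ur in auto)
  qed
  interpret entropy_slices f u0 u v M L g0 ul "f' ul" E K0
    by unfold_locales
      (use weak Linf_u u_bound slice_meas v tc f_meas lip L(1) g0 u0_meas M(2) tangent E(1) oleinik K0
        in \<open>auto simp: Linf_def\<close>)
  define C where "C = sqrt (4 * E * (2 * (K0 + 4 * M + 2) + 4 * M))"
  \<comment> \<open>The summand 2 keeps \<open>C\<close> positive even when \<open>K0\<close> and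
    \<open>M\<close> vanish.\<close>
  have "C > 0" using E(1) K0_nonneg M(1) by (simp add: C_def)
  moreover have "esssup lebesgue (\<lambda>x. ereal \<bar>u x t - ul\<bar>) \<le> ereal (C / sqrt t)" if "t > 0" for t
  proof (rule esssup_I)
    note [measurable] = slice_meas[OF that]
    show "(\<lambda>x. ereal \<bar>u x t - ul\<bar>) \<in> borel_measurable lebesgue" by measurable
    show "AE x in lebesgue. ereal \<bar>u x t - ul\<bar> \<le> ereal (C / sqrt t)"
      using AE_completion[OF decay[OF that]] v(3)[OF that] by eventually_elim (simp add: C_def)
  qed
  ultimately show ?thesis by blast
qed

end
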